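(* Let $\{Z_1(t)\}_{t\ge0}$ be the time-changed compound Poisson process of order $k$, $Z_1(t)=Z(S_{\alpha_1,\alpha_2}^{\mu_1,\mu_2}(t))$, denoted $TCPPoK(\lambda,H,S_{\alpha_1,\alpha_2}^{\mu_1,\mu_2})$. Then $\{Z_1(t)\}_{t\ge0}$ has the long-range dependence (LRD) property.
   Context: Fix an integer $k\ge1$ and $\lambda>0$. Poisson process of order $k$, $PPoK(\lambda)$: $N^{(k)}(t)=\sum_{i=1}^{N(t)}X_i$, where $\{N(t)\}_{t\ge0}$ is a Poisson process with rate $k\lambda$ and $\{X_i\}_{i\ge1}$ are i.i.d. discrete uniform on $\{1,\dots,k\}$, independent of $\{N(t)\}$. Compound Poisson process of order $k$, $CPPoK(\lambda,H)$: $Z(t)=\sum_{i=1}^{N^{(k)}(t)}Y_i$, where $\{N^{(k)}(t)\}_{t\ge0}$ is $PPoK(\lambda)$ and $\{Y_i\}_{i\ge1}$ are i.i.d. random variables with cumulative distribution function $H$, independent of $\{N^{(k)}(t)\}$. Mixture of tempered stable subordinators (MTSS): $\{S_{\alpha_1,\alpha_2}^{\mu_1,\mu_2}(t)\}_{t\ge0}$ is the Lévy subordinator (one-dimensional non-decreasing Lévy process) with $$\mathbb{E}[e^{-uS_{\alpha_1,\alpha_2}^{\mu_1,\mu_2}(t)}]=\exp\{-t(c_1((u+\mu_1)^{\alpha_1}-\mu_1^{\alpha_1})+c_2((u+\mu_2)^{\alpha_2}-\mu_2^{\alpha_2}))\},\quad u>0,$$ where $c_1,c_2\ge0$, $c_1+c_2=1$,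 $\mu_1,\mu_2>0$, $\alpha_1,\alpha_2\in(0,1)$. $TCPPoK(\lambda,H,S_{\alpha_1,\alpha_2}^{\mu_1,\mu_2})$: with $\mathbb{E}[S_{\alpha_1,\alpha_2}^{\mu_1,\mu_2}(t)^{\rho}]<\infty$ for all $\rho>0$, $Z_1(t)=Z(S_{\alpha_1,\alpha_2}^{\mu_1,\mu_2}(t))$, where $\{Z(t)\}_{t\ge0}$ is $CPPoK(\lambda,H)$, independent of $\{S_{\alpha_1,\alpha_2}^{\mu_1,\mu_2}(t)\}_{t\ge0}$. Long-range dependence: let $0\le s<t$ with $s$ fixed. Assume a stochastic process $\{X(t)\}_{t\ge0}$ has a correlation function satisfying $c_1(s)t^{-d}\le \mathrm{Corr}[X(s),X(t)]\le c_2(s)t^{-d}$ for large $t$, with $d>0$ and $c_1(s)>0$, $c_2(s)>0$ (functions of $s$, unrelated to the mixture weights above), i.e. $$\lim_{t\to\infty}\frac{\mathrm{Corr}[X(s),X(t)]}{t^{-d}}=c(s)$$ for some $c(s)>0$ and $d>0$. Then $X(t)$ is said to have the long-range dependence (LRD) property if $d\in(0,1)$.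
   Formalization: The distribution H of the jumps is assumed to have a finite second moment and not to be that of the constant 0; otherwise the correlation is undefined. The LRD condition is asserted for fixed s > 0, since the variance is zero at s = 0. *)

theory Defs
  imports "HOL-Probability.Probability"
begin

context prob_space
begin

section \<open>Independence of whole families\<close>

text \<open>
  The constant \<open>indep_var\<close> needs both random elements to have the same type. Here, for
  instance, a process indexed by real time has to be independent of a sequence indexed by natural
  numbers, so independence is stated for the two generated sigma-algebras.
\<close>

definition family_sigma :: "'i set \<Rightarrow> 'b measure \<Rightarrow> ('i \<Rightarrow> 'a \<Rightarrow> 'b) \<Rightarrow> 'a set set" where
  "family_sigma I B X =
     sets (vimage_algebra (space M) (\<lambda>\<omega>. \<lambda>i\<in>I. X i \<omega>) (\<Pi>\<^sub>M i\<in>I. B))"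

definition indep_families ::
  "'i set \<Rightarrow> 'b measure \<Rightarrow> ('i \<Rightarrow> 'a \<Rightarrow> 'b) \<Rightarrow> 'j set \<Rightarrow> 'c measure \<Rightarrow> ('j \<Rightarrow> 'a \<Rightarrow> 'c) \<Rightarrow> bool" where
  "indep_families I B X J C Y \<longleftrightarrow>
     (\<forall>i\<in>I. X i \<in> measurable M B) \<and> (\<forall>j\<in>J. Y j \<in> measurable M C) \<and>
     indep_set (family_sigma I B X) (family_sigma J C Y)"


section \<open>Levy processes, Poisson processes, subordinators\<close>

definition independent_increments :: "(real \<Rightarrow> 'a \<Rightarrow> real) \<Rightarrow> bool" where
  "independent_increments X \<longleftrightarrow>
     (\<forall>n (t :: nat \<Rightarrow> real). 0 \<le> t 0 \<longrightarrow> (\<forall>i<n. t i \<le> t (Suc i)) \<longrightarrow>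
        indep_vars (\<lambda>_. borel) (\<lambda>i \<omega>. X (t (Suc i)) \<omega> - X (t i) \<omega>) {..<n})"

definition stationary_increments :: "(real \<Rightarrow> 'a \<Rightarrow> real) \<Rightarrow> bool" where
  "stationary_increments X \<longleftrightarrow>
     (\<forall>s\<ge>0. \<forall>h\<ge>0. distr M borel (\<lambda>\<omega>. X (s + h) \<omega> - X s \<omega>)
                 = distr M borel (\<lambda>\<omega>. X h \<omega> - X 0 \<omega>))"

definition stochastically_continuous :: "(real \<Rightarrow> 'a \<Rightarrow> real) \<Rightarrow> bool" where
  "stochastically_continuous X \<longleftrightarrow>
     (\<forall>t\<ge>0. \<forall>\<epsilon>>0.
        ((\<lambda>s. prob {\<omega>\<in>space M. \<epsilon> < \<bar>X s \<omega> - X t \<omega>\<bar>}) \<longlongrightarrow> 0) (at t within {0..}))"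

definition cadlag_path :: "(real \<Rightarrow> real) \<Rightarrow> bool" where
  "cadlag_path x \<longleftrightarrow>
     (\<forall>t\<ge>0. continuous (at_right t) x) \<and> (\<forall>t>0. \<exists>l. (x \<longlongrightarrow> l) (at_left t))"

definition levy_process :: "(real \<Rightarrow> 'a \<Rightarrow> real) \<Rightarrow> bool" where
  "levy_process X \<longleftrightarrow>
     (\<forall>t\<ge>0. random_variable borel (X t)) \<and>
     (AE \<omega> in M. X 0 \<omega> = 0) \<and>
     independent_increments X \<and>
     stationary_increments X \<and>
     stochastically_continuous X \<and>
     (AE \<omega> in M. cadlag_path (\<lambda>t. X t \<omega>))"

definition poisson_process :: "real \<Rightarrow> (real \<Rightarrow> 'a \<Rightarrow> nat) \<Rightarrow> bool" where
  "poisson_process r N \<longleftrightarrow>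
     levy_process (\<lambda>t \<omega>. real (N t \<omega>)) \<and>
     (\<forall>t>0. distr M (count_space UNIV) (N t) = measure_pmf (poisson_pmf (r * t)))"

definition subordinator :: "(real \<Rightarrow> 'a \<Rightarrow> real) \<Rightarrow> bool" where
  "subordinator S \<longleftrightarrow> levy_process S \<and> (AE \<omega> in M. mono_on {0..} (\<lambda>t. S t \<omega>))"

definition mtss ::
  "real \<Rightarrow> real \<Rightarrow> real \<Rightarrow> real \<Rightarrow> real \<Rightarrow> real \<Rightarrow> (real \<Rightarrow> 'a \<Rightarrow> real) \<Rightarrow> bool" where
  "mtss c1 c2 \<mu>1 \<mu>2 \<alpha>1 \<alpha>2 S \<longleftrightarrow>
     subordinator S \<and>
     (\<forall>t\<ge>0. \<forall>u>0. expectation (\<lambda>\<omega>. exp (- u * S t \<omega>)) =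
        exp (- t * (c1 * ((u + \<mu>1) powr \<alpha>1 - \<mu>1 powr \<alpha>1)
                  + c2 * ((u + \<mu>2) powr \<alpha>2 - \<mu>2 powr \<alpha>2))))"


section \<open>Poisson and compound Poisson processes of order \<open>k\<close>\<close>

definition ppok :: "nat \<Rightarrow> real \<Rightarrow> (real \<Rightarrow> 'a \<Rightarrow> nat) \<Rightarrow> bool" where
  "ppok k r Nk \<longleftrightarrow>
     (\<exists>(N :: real \<Rightarrow> 'a \<Rightarrow> nat) (X :: nat \<Rightarrow> 'a \<Rightarrow> nat).
        poisson_process (real k * r) N \<and>
        indep_vars (\<lambda>_. count_space UNIV) X {1..} \<and>
        (\<forall>i\<ge>1. distr M (count_space UNIV) (X i) = measure_pmf (pmf_of_set {1..k})) \<and>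
        indep_families {0..} (count_space UNIV) N {1..} (count_space UNIV) X \<and>
        (\<forall>t\<ge>0. \<forall>\<omega>\<in>space M. Nk t \<omega> = (\<Sum>i = 1..N t \<omega>. X i \<omega>)))"

definition cppok :: "nat \<Rightarrow> real \<Rightarrow> (real \<Rightarrow> real) \<Rightarrow> (real \<Rightarrow> 'a \<Rightarrow> real) \<Rightarrow> bool" where
  "cppok k r H Z \<longleftrightarrow>
     (\<exists>(Nk :: real \<Rightarrow> 'a \<Rightarrow> nat) (Y :: nat \<Rightarrow> 'a \<Rightarrow> real).
        ppok k r Nk \<and>
        indep_vars (\<lambda>_. borel) Y {1..} \<and>
        (\<forall>i\<ge>1. cdf (distr M borel (Y i)) = H) \<and>
        indep_families {0..} (count_space UNIV) Nk {1..} borel Y \<and>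
        (\<forall>t\<ge>0. \<forall>\<omega>\<in>space M. Z t \<omega> = (\<Sum>i = 1..Nk t \<omega>. Y i \<omega>)))"

text \<open>
  Path properties of the processes are only required almost surely, so the composite
  \<open>Z (S t \<omega>) \<omega>\<close> is automatically a random variable only up to a null set; the first
  conjunct records that \<open>Z1\<close> is a stochastic process.
\<close>

definition tcppok ::
  "nat \<Rightarrow> real \<Rightarrow> (real \<Rightarrow> real) \<Rightarrow> (real \<Rightarrow> 'a \<Rightarrow> real) \<Rightarrow> (real \<Rightarrow> 'a \<Rightarrow> real) \<Rightarrow> bool" where
  "tcppok k r H S Z1 \<longleftrightarrow>
     (\<forall>t\<ge>0. random_variable borel (Z1 t)) \<and>
     (\<forall>t\<ge>0. \<forall>\<rho>>0. integrable M (\<lambda>\<omega>. S t \<omega> powr \<rho>)) \<and>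
     (\<exists>Z. cppok k r H Z \<and>
        indep_families {0..} borel Z {0..} borel S \<and>
        (\<forall>t\<ge>0. \<forall>\<omega>\<in>space M. Z1 t \<omega> = Z (S t \<omega>) \<omega>))"


section \<open>Long-range dependence\<close>

definition covar :: "('a \<Rightarrow> real) \<Rightarrow> ('a \<Rightarrow> real) \<Rightarrow> real" where
  "covar X Y = expectation (\<lambda>\<omega>. (X \<omega> - expectation X) * (Y \<omega> - expectation Y))"

definition corr :: "('a \<Rightarrow> real) \<Rightarrow> ('a \<Rightarrow> real) \<Rightarrow> real" where
  "corr X Y = covar X Y / sqrt (variance X * variance Y)"

text \<open>
  The first two conjuncts make the correlation function genuinely defined. The time \<open>s = 0\<close> is
  left out because a process started at a constant has variance zero there, so that its
  correlation with later values is undefined. The exponent \<open>d\<close> does not depend on \<open>s\<close>. The limit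
  implies the two-sided bound on the correlation, see \<open>lrd_limit_imp_bounds\<close>.
\<close>

definition long_range_dependent :: "(real \<Rightarrow> 'a \<Rightarrow> real) \<Rightarrow> bool" where
  "long_range_dependent X \<longleftrightarrow>
     (\<forall>t\<ge>0. random_variable borel (X t) \<and> integrable M (\<lambda>\<omega>. (X t \<omega>)\<^sup>2)) \<and>
     (\<forall>t>0. variance (X t) > 0) \<and>
     (\<exists>d c. 0 < d \<and> d < 1 \<and>
        (\<forall>s>0. 0 < c s \<and> ((\<lambda>t. corr (X s) (X t) / t powr (- d)) \<longlongrightarrow> c s) at_top))"

lemma lrd_limit_imp_bounds:
  fixes c d s :: real
  assumes c: "0 < c"
    and lim: "((\<lambda>t. corr (X s) (X t) / t powr (- d)) \<longlongrightarrow> c) at_top"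
  shows "\<exists>a>0. \<exists>b>0. \<forall>\<^sub>F t in at_top.
           a * t powr (- d) \<le> corr (X s) (X t) \<and> corr (X s) (X t) \<le> b * t powr (- d)"
proof -
  have "\<forall>\<^sub>F t in at_top. c / 2 < corr (X s) (X t) / t powr (- d)"
    using c by (intro order_tendstoD(1)[OF lim]) simp
  moreover have "\<forall>\<^sub>F t in at_top. corr (X s) (X t) / t powr (- d) < 2 * c"
    using c by (intro order_tendstoD(2)[OF lim]) simp
  moreover have "\<forall>\<^sub>F t :: real in at_top. 0 < t"
    by (rule eventually_gt_at_top)
  ultimately have "\<forall>\<^sub>F t in at_top. c / 2 * t powr (- d) \<le> corr (X s) (X t) \<and>
      corr (X s) (X t) \<le> 2 * c * t powr (- d)"
  proof eventually_elim
    case (elim t)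
    have "0 < t powr (- d)" using elim by simp
    with elim(1,2) show ?case
      by (simp only: pos_less_divide_eq pos_divide_less_eq) simp
  qed
  with c show ?thesis
    by (intro exI[of _ "c / 2"] conjI exI[of _ "2 * c"]) auto
qed

end

end

theory Submission
  imports Defs
begin

text \<open>
  A square-integrable Levy process has mean \<open>a t\<close> and covariance \<open>v min(s, t)\<close>, and so does the
  walk with independent identically distributed steps. This second-order structure survives an independent monotone
  time change whose clock has it with parameters \<open>(b, w)\<close>: the new parameters are \<open>(a b, v b + a\<^sup>2 w)\<close>.
  Applying this to the uniform walk run by the Poisson process, then to the \<open>Y\<close>-walk run by
  the resulting process, and finally to \<open>Z\<close> run by the subordinator, one finds
  \<open>Cov(Z1 s, Z1 t) = V min(s, t)\<close> with \<open>V > 0\<close>. Hence \<open>Corr(Z1 s, Z1 t) = sqrt (s / t)\<close> for \<open>s \<le> t\<close>, which is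
  long-range dependence with exponent \<open>1/2\<close>.
\<close>

text \<open>Each change of clock rests on freezing the index and integrating the other process.
  Independence is given between sigma-algebras and path regularity holds only almost surely, so
  joint measurability in time and outcome is not at hand; freezing is justified only for an index
  with countably many values. Counting clocks have this property. The subordinator does not, so it
  is replaced by dyadic values and the formula is recovered in the limit. The rate
  \<open>v * b + a\<^sup>2 * w\<close> is the law of total variance. Its two terms guard against
  different degeneracies: centred jumps annihilate the second, deterministic jumps the first. Hence
  the counting processes are shown to have a strictly positive variance rate, whereas a positive
  mean rate is enough for the subordinator. The rates are never computed, since the correlation
  depends on none of them.\<close>

context prob_space
begin

section \<open>Integration over an independent countable index\<close>

text \<open>For an indicator this is the product rule for independent events; linearity and monotone
  limits give the rest. \<open>F\<close> and \<open>G\<close> serve only as carriers of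
  sigma-algebras on the space of \<open>M\<close>, and the induction runs over functions measurable
  for \<open>F\<close>, because the product rule is available for those alone.\<close>

lemma nn_integral_indep_indicator:
  fixes f :: "'a \<Rightarrow> ennreal"
  assumes ind: "indep_set (sets F) (sets G)" and sp: "space F = space M"
    and f: "f \<in> borel_measurable F" and E: "E \<in> sets G"
  shows "(\<integral>\<^sup>+\<omega>. f \<omega> * indicator E \<omega> \<partial>M) = (\<integral>\<^sup>+\<omega>. f \<omega> \<partial>M) * emeasure M E"
proof -
  have sub: "sets F \<subseteq> events" "sets G \<subseteq> events"
    using ind by (auto simp: indep_sets2_eq)
  have E': "E \<in> events" using E sub by blast
  have meas: "h \<in> borel_measurable M" if "h \<in> borel_measurable F" for h :: "'a \<Rightarrow> ennreal"
    using that sub(1) sp by (auto simp: measurable_def)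
  show ?thesis using f
  proof (induction rule: borel_measurable_induct)
    case (cong f g)
    then have "\<And>\<omega>. \<omega> \<in> space M \<Longrightarrow> f \<omega> = g \<omega>" using sp by auto
    then have "(\<integral>\<^sup>+\<omega>. f \<omega> \<partial>M) = (\<integral>\<^sup>+\<omega>. g \<omega> \<partial>M)"
      "(\<integral>\<^sup>+\<omega>. f \<omega> * indicator E \<omega> \<partial>M) = (\<integral>\<^sup>+\<omega>. g \<omega> * indicator E \<omega> \<partial>M)"
      by (auto intro!: nn_integral_cong)
    with cong show ?case by simp
  next
    case (set A)
    then have A: "A \<in> events" using sub by blast
    have "(\<integral>\<^sup>+\<omega>. indicator A \<omega> * indicator E \<omega> \<partial>M) = emeasure M (A \<inter> E)"
      using A E' by (simp flip: indicator_inter_arith)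
    also have "\<dots> = emeasure M A * emeasure M E"
      using indep_setD[OF ind set E] by (simp add: emeasure_eq_measure ennreal_mult)
    finally show ?case using A by simp
  next
    case (mult u c)
    note [measurable] = meas[OF mult(2)] E'
    show ?case using mult by (simp add: nn_integral_cmult mult.assoc)
  next
    case (add u v)
    note [measurable] = meas[OF \<open>u \<in> borel_measurable F\<close>] meas[OF \<open>v \<in> borel_measurable F\<close>] E'
    show ?case using add by (simp add: nn_integral_add distrib_right)
  next
    case (seq U)
    note [measurable] = meas[OF seq(1)] E'
    have *: "(SUP i. U i) \<omega> * indicator E \<omega> = (SUP i. U i \<omega> * indicator E \<omega>)" for \<omega>
      by (simp add: SUP_mult_right_ennreal image_comp)
    have inc: "incseq (\<lambda>i \<omega>. U i \<omega> * indicator E \<omega>)"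
      using seq(3) by (auto simp: incseq_def le_fun_def intro!: mult_right_mono)
    have "(\<integral>\<^sup>+\<omega>. (SUP i. U i) \<omega> * indicator E \<omega> \<partial>M) = (SUP i. \<integral>\<^sup>+\<omega>. U i \<omega> * indicator E \<omega> \<partial>M)"
      unfolding * by (rule nn_integral_monotone_convergence_SUP[OF inc]) simp
    also have "\<dots> = (SUP i. (\<integral>\<^sup>+\<omega>. U i \<omega> \<partial>M)) * emeasure M E"
      using seq.IH by (simp add: SUP_mult_right_ennreal)
    also have "(SUP i. (\<integral>\<^sup>+\<omega>. U i \<omega> \<partial>M)) = (\<integral>\<^sup>+\<omega>. (SUP i. U i) \<omega> \<partial>M)"
      using nn_integral_monotone_convergence_SUP[OF seq(3)] by (simp add: image_comp)
    finally show ?case .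
  qed
qed

lemma nn_integral_indep_index:
  fixes g :: "'j::countable \<Rightarrow> 'a \<Rightarrow> ennreal"
  assumes ind: "indep_set (sets F) (sets G)" and sp: "space F = space M" "space G = space M"
    and g: "\<And>j. g j \<in> borel_measurable F" and J: "J \<in> measurable G (count_space UNIV)"
  shows "(\<integral>\<^sup>+\<omega>. g (J \<omega>) \<omega> \<partial>M) = (\<integral>\<^sup>+\<omega>. (\<integral>\<^sup>+\<omega>'. g (J \<omega>) \<omega>' \<partial>M) \<partial>M)"
proof -
  have sub: "sets F \<subseteq> events" "sets G \<subseteq> events"
    using ind by (auto simp: indep_sets2_eq)
  have [measurable]: "g j \<in> borel_measurable M" for j
    using g[of j] sub(1) sp by (auto simp: measurable_def)
  define A where "A n = {\<omega>\<in>space M. to_nat (J \<omega>) = n}" for n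
  have AG: "A n \<in> sets G" for n
  proof -
    have "{\<omega>\<in>space G. to_nat (J \<omega>) = n} \<in> sets G" using J by measurable
    then show ?thesis by (simp add: A_def sp)
  qed
  then have [measurable]: "A n \<in> events" for n using sub by blast
  \<comment> \<open>The events are numbered by the codes of the indices. For an \<open>n\<close>
    that is no code, \<open>from_nat n\<close> is an arbitrary value, but then \<open>A n\<close> is
    empty and the term vanishes.\<close>
  have dec: "h (J \<omega>) = (\<Sum>n. h (from_nat n) * indicator (A n) \<omega>)" if "\<omega> \<in> space M"
    for h :: "'j \<Rightarrow> ennreal" and \<omega>
  proof -
    have "(\<Sum>n. h (from_nat n) * indicator (A n) \<omega>)
        = (\<Sum>n\<in>{to_nat (J \<omega>)}. h (from_nat n) * indicator (A n) \<omega>)"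
      by (rule suminf_finite) (auto simp: A_def)
    then show ?thesis using that by (simp add: A_def)
  qed
  have "(\<integral>\<^sup>+\<omega>. g (J \<omega>) \<omega> \<partial>M) = (\<integral>\<^sup>+\<omega>. (\<Sum>n. g (from_nat n) \<omega> * indicator (A n) \<omega>) \<partial>M)"
    by (intro nn_integral_cong) (rule dec[of _ "\<lambda>j. g j _"])
  also have "\<dots> = (\<Sum>n. \<integral>\<^sup>+\<omega>. g (from_nat n) \<omega> * indicator (A n) \<omega> \<partial>M)"
    by (rule nn_integral_suminf) simp
  also have "\<dots> = (\<Sum>n. (\<integral>\<^sup>+\<omega>. g (from_nat n) \<omega> \<partial>M) * emeasure M (A n))"
    using nn_integral_indep_indicator[OF ind sp(1) g AG] by simp
  also have "\<dots> = (\<Sum>n. \<integral>\<^sup>+\<omega>. (\<integral>\<^sup>+\<omega>'. g (from_nat n) \<omega>' \<partial>M) * indicator (A n) \<omega> \<partial>M)"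
    by (simp add: nn_integral_cmult)
  also have "\<dots> = (\<integral>\<^sup>+\<omega>. (\<Sum>n. (\<integral>\<^sup>+\<omega>'. g (from_nat n) \<omega>' \<partial>M) * indicator (A n) \<omega>) \<partial>M)"
    by (rule nn_integral_suminf[symmetric]) simp
  also have "\<dots> = (\<integral>\<^sup>+\<omega>. (\<integral>\<^sup>+\<omega>'. g (J \<omega>) \<omega>' \<partial>M) \<partial>M)"
    by (intro nn_integral_cong) (use dec[of _ "\<lambda>j. \<integral>\<^sup>+\<omega>'. g j \<omega>' \<partial>M"] in auto)
  finally show ?thesis .
qed

lemma integral_indep_index_nonneg:
  fixes g :: "'j::countable \<Rightarrow> 'a \<Rightarrow> real"
  assumes ind: "indep_set (sets F) (sets G)" and sp: "space F = space M" "space G = space M"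
    and g: "\<And>j. g j \<in> borel_measurable F" and J: "J \<in> measurable G (count_space UNIV)"
    and nn: "\<And>j \<omega>. 0 \<le> g j \<omega>"
    and gi: "\<And>j. integrable M (g j)" and Ji: "integrable M (\<lambda>\<omega>. expectation (g (J \<omega>)))"
  shows "integrable M (\<lambda>\<omega>. g (J \<omega>) \<omega>)"
    and "expectation (\<lambda>\<omega>. g (J \<omega>) \<omega>) = expectation (\<lambda>\<omega>. expectation (g (J \<omega>)))"
proof -
  have sub: "sets F \<subseteq> events" "sets G \<subseteq> events"
    using ind by (auto simp: indep_sets2_eq)
  have [measurable]: "g j \<in> borel_measurable M" for j using gi by auto
  have [measurable]: "J \<in> measurable M (count_space UNIV)"
    using J sub(2) sp by (auto simp: measurable_def)
  have m: "(\<lambda>\<omega>. g (J \<omega>) \<omega>) \<in> borel_measurable M"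
    by (rule measurable_compose_countable[where f=g and g=J]) auto
  have "(\<integral>\<^sup>+\<omega>. ennreal (g (J \<omega>) \<omega>) \<partial>M) = (\<integral>\<^sup>+\<omega>. (\<integral>\<^sup>+\<omega>'. ennreal (g (J \<omega>) \<omega>') \<partial>M) \<partial>M)"
    by (rule nn_integral_indep_index[OF ind sp _ J]) (use g in measurable)
  also have "\<dots> = (\<integral>\<^sup>+\<omega>. ennreal (expectation (g (J \<omega>))) \<partial>M)"
    by (simp add: nn_integral_eq_integral[OF gi] nn)
  also have "\<dots> = ennreal (expectation (\<lambda>\<omega>. expectation (g (J \<omega>))))"
    by (rule nn_integral_eq_integral[OF Ji]) (simp add: nn)
  finally have *: "(\<integral>\<^sup>+\<omega>. ennreal (g (J \<omega>) \<omega>) \<partial>M) = ennreal (expectation (\<lambda>\<omega>. expectation (g (J \<omega>))))" .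
  show "integrable M (\<lambda>\<omega>. g (J \<omega>) \<omega>)"
    by (rule integrableI_nn_integral_finite[OF m _ *]) (simp add: nn)
  show "expectation (\<lambda>\<omega>. g (J \<omega>) \<omega>) = expectation (\<lambda>\<omega>. expectation (g (J \<omega>)))"
    using * by (intro integral_eq_nn_integral[OF m, THEN trans]) (auto simp: nn)
qed

text \<open>The bound \<open>q\<close> makes both \<open>q\<close> and \<open>q + g\<close>
  nonnegative, so the nonnegative case applies to each, and subtraction gives
  \<open>g\<close>.\<close>

lemma integral_indep_index:
  fixes g q :: "'j::countable \<Rightarrow> 'a \<Rightarrow> real"
  assumes ind: "indep_set (sets F) (sets G)" and sp: "space F = space M" "space G = space M"
    and g: "\<And>j. g j \<in> borel_measurable F" and q: "\<And>j. q j \<in> borel_measurable F"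
    and J: "J \<in> measurable G (count_space UNIV)"
    and le: "\<And>j \<omega>. \<bar>g j \<omega>\<bar> \<le> q j \<omega>"
    and qi: "\<And>j. integrable M (q j)" and Ji: "integrable M (\<lambda>\<omega>. expectation (q (J \<omega>)))"
  shows "integrable M (\<lambda>\<omega>. g (J \<omega>) \<omega>)"
    and "expectation (\<lambda>\<omega>. g (J \<omega>) \<omega>) = expectation (\<lambda>\<omega>. expectation (g (J \<omega>)))"
proof -
  have sub: "sets F \<subseteq> events" "sets G \<subseteq> events"
    using ind by (auto simp: indep_sets2_eq)
  have gm [measurable]: "g j \<in> borel_measurable M" for j
    using g[of j] sub(1) sp by (auto simp: measurable_def)
  have [measurable]: "J \<in> measurable M (count_space UNIV)"
    using J sub(2) sp by (auto simp: measurable_def)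
  have qnn: "0 \<le> q j \<omega>" for j \<omega> using le[of j \<omega>] by linarith
  have gi: "integrable M (g j)" for j
    by (rule Bochner_Integration.integrable_bound[OF qi[of j]]) (use le qnn in auto)
  have gJ: "integrable M (\<lambda>\<omega>. expectation (g (J \<omega>)))"
  proof (rule Bochner_Integration.integrable_bound[OF Ji])
    show "AE \<omega> in M. norm (expectation (g (J \<omega>))) \<le> norm (expectation (q (J \<omega>)))"
    proof (rule AE_I2)
      fix \<omega>
      have "norm (expectation (g (J \<omega>))) \<le> expectation (\<lambda>x. norm (g (J \<omega>) x))"
        by (rule integral_norm_bound)
      also have "\<dots> \<le> expectation (q (J \<omega>))"
        by (rule integral_mono) (use gi qi le in auto)
      finally show "norm (expectation (g (J \<omega>))) \<le> norm (expectation (q (J \<omega>)))" by simp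
    qed
  qed simp
  have e: "expectation (\<lambda>\<omega>. q j \<omega> + g j \<omega>) = expectation (q j) + expectation (g j)" for j
    using gi qi by simp
  have 1: "integrable M (\<lambda>\<omega>. q (J \<omega>) \<omega>)"
    "expectation (\<lambda>\<omega>. q (J \<omega>) \<omega>) = expectation (\<lambda>\<omega>. expectation (q (J \<omega>)))"
    using integral_indep_index_nonneg[OF ind sp q J qnn qi Ji] by auto
  have nn: "0 \<le> q j \<omega> + g j \<omega>" for j \<omega> using le[of j \<omega>] by linarith
  have m: "(\<lambda>\<omega>. q j \<omega> + g j \<omega>) \<in> borel_measurable F" for j using q g by measurable
  have 2: "integrable M (\<lambda>\<omega>. q (J \<omega>) \<omega> + g (J \<omega>) \<omega>)"
    "expectation (\<lambda>\<omega>. q (J \<omega>) \<omega> + g (J \<omega>) \<omega>) = expectation (\<lambda>\<omega>. expectation (\<lambda>x. q (J \<omega>) x + g (J \<omega>) x))"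
    using integral_indep_index_nonneg[where g="\<lambda>j \<omega>. q j \<omega> + g j \<omega>", OF ind sp m J nn] gi qi Ji gJ e by auto
  have "integrable M (\<lambda>\<omega>. (q (J \<omega>) \<omega> + g (J \<omega>) \<omega>) - q (J \<omega>) \<omega>)"
    using 2(1) 1(1) by (rule Bochner_Integration.integrable_diff)
  then show 3: "integrable M (\<lambda>\<omega>. g (J \<omega>) \<omega>)" by simp
  show "expectation (\<lambda>\<omega>. g (J \<omega>) \<omega>) = expectation (\<lambda>\<omega>. expectation (g (J \<omega>)))"
    using 2(2) 1 3 e Ji gJ by simp
qed

section \<open>Linear first and second moments, and their behaviour under integer clocks\<close>

text \<open>
  The map \<open>\<tau>\<close> turns an index into a time, so that walks indexed by \<open>nat\<close>, their dyadically rescaled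
  versions and processes in real time are covered at once.
\<close>

definition linear_moments :: "real \<Rightarrow> real \<Rightarrow> 'i set \<Rightarrow> ('i \<Rightarrow> real) \<Rightarrow> ('i \<Rightarrow> 'a \<Rightarrow> real) \<Rightarrow> bool" where
  "linear_moments a v T \<tau> U \<longleftrightarrow>
     (\<forall>i\<in>T. U i \<in> borel_measurable M \<and> integrable M (\<lambda>\<omega>. (U i \<omega>)\<^sup>2) \<and> expectation (U i) = a * \<tau> i) \<and>
     (\<forall>i\<in>T. \<forall>j\<in>T. expectation (\<lambda>\<omega>. U i \<omega> * U j \<omega>) = v * min (\<tau> i) (\<tau> j) + a\<^sup>2 * \<tau> i * \<tau> j)"

lemma integrable_prod_of_squares:
  assumes "U \<in> borel_measurable M" "V \<in> borel_measurable M"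
    and "integrable M (\<lambda>\<omega>. (U \<omega>)\<^sup>2)" "integrable M (\<lambda>\<omega>. (V \<omega>)\<^sup>2)"
  shows "integrable M (\<lambda>\<omega>. U \<omega> * V \<omega> :: real)"
proof (rule Bochner_Integration.integrable_bound)
  show "integrable M (\<lambda>\<omega>. (U \<omega>)\<^sup>2 + (V \<omega>)\<^sup>2)" using assms by simp
  have "\<bar>x * y\<bar> \<le> x\<^sup>2 + y\<^sup>2" for x y :: real
  proof -
    have "0 \<le> (\<bar>x\<bar> - \<bar>y\<bar>)\<^sup>2" by simp
    then have "2 * \<bar>x * y\<bar> \<le> x\<^sup>2 + y\<^sup>2" by (simp add: power2_diff abs_mult)
    then show ?thesis by linarith
  qed
  then show "AE \<omega> in M. norm (U \<omega> * V \<omega>) \<le> norm ((U \<omega>)\<^sup>2 + (V \<omega>)\<^sup>2)" by auto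
qed (use assms in simp)

lemma integrable_of_square:
  assumes "U \<in> borel_measurable M" "integrable M (\<lambda>\<omega>. (U \<omega>)\<^sup>2)"
  shows "integrable M (U :: 'a \<Rightarrow> real)"
  using integrable_prod_of_squares[of U "\<lambda>_. 1"] assms by simp

text \<open>With the indices frozen at n and m the moments of \<open>U\<close> are explicit
  polynomials in n, m and their minimum; substituting \<open>R\<close> and \<open>R'\<close> and
  integrating once more gives the claim. No order between \<open>R\<close> and \<open>R'\<close> is
  assumed, so the expected minimum remains in the formula.\<close>

lemma indep_index_moments:
  fixes U :: "nat \<Rightarrow> 'a \<Rightarrow> real" and R R' :: "'a \<Rightarrow> nat"
  assumes ind: "indep_set (sets F) (sets G)" and sp: "space F = space M" "space G = space M"
    and U: "\<And>n. U n \<in> borel_measurable F"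
    and R: "R \<in> measurable G (count_space UNIV)" "R' \<in> measurable G (count_space UNIV)"
    and lin: "linear_moments a v UNIV real U"
    and R2: "integrable M (\<lambda>\<omega>. (real (R \<omega>))\<^sup>2)" "integrable M (\<lambda>\<omega>. (real (R' \<omega>))\<^sup>2)"
  shows "(\<lambda>\<omega>. U (R \<omega>) \<omega>) \<in> borel_measurable M"
    and "integrable M (\<lambda>\<omega>. (U (R \<omega>) \<omega>)\<^sup>2)"
    and "expectation (\<lambda>\<omega>. U (R \<omega>) \<omega>) = a * expectation (\<lambda>\<omega>. real (R \<omega>))"
    and "expectation (\<lambda>\<omega>. U (R \<omega>) \<omega> * U (R' \<omega>) \<omega>) =
      v * expectation (\<lambda>\<omega>. real (min (R \<omega>) (R' \<omega>))) + a\<^sup>2 * expectation (\<lambda>\<omega>. real (R \<omega>) * real (R' \<omega>))"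
proof -
  have [measurable]: "U n \<in> borel_measurable M" for n using lin by (auto simp: linear_moments_def)
  have subG: "sets G \<subseteq> events" using ind by (auto simp: indep_sets2_eq)
  have [measurable]: "R \<in> measurable M (count_space UNIV)" "R' \<in> measurable M (count_space UNIV)"
    using R subG sp by (auto simp: measurable_def)
  note [measurable] = R
  note [measurable (raw)] = U
  show mU: "(\<lambda>\<omega>. U (R \<omega>) \<omega>) \<in> borel_measurable M"
    by (rule measurable_compose_countable[where f=U and g=R]) auto
  have iU: "integrable M (U n)" "integrable M (\<lambda>\<omega>. (U n \<omega>)\<^sup>2)" for n
    using lin integrable_of_square[of "U n"] by (auto simp: linear_moments_def)
  have iUU: "integrable M (\<lambda>\<omega>. U n \<omega> * U m \<omega>)" for n m
    using iU integrable_prod_of_squares[of "U n" "U m"] by simp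
  have eU: "expectation (U n) = a * real n" for n using lin by (auto simp: linear_moments_def)
  have eUU: "expectation (\<lambda>\<omega>. U n \<omega> * U m \<omega>) = v * real (min n m) + a\<^sup>2 * real n * real m" for n m
    using lin by (auto simp: linear_moments_def of_nat_min)
  have eU2: "expectation (\<lambda>\<omega>. (U n \<omega>)\<^sup>2) = v * real n + a\<^sup>2 * (real n)\<^sup>2" for n
    using eUU[of n n] by (simp add: power2_eq_square)
  have iR: "integrable M (\<lambda>\<omega>. real (R \<omega>))" "integrable M (\<lambda>\<omega>. real (R' \<omega>))"
    using R2 by (auto intro: integrable_of_square)
  have iRR: "integrable M (\<lambda>\<omega>. real (R \<omega>) * real (R' \<omega>))"
    using R2 by (intro integrable_prod_of_squares) auto
  have imin: "integrable M (\<lambda>\<omega>. real (min (R \<omega>) (R' \<omega>)))"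
    by (rule Bochner_Integration.integrable_bound[OF iR(1)]) auto
  show "integrable M (\<lambda>\<omega>. (U (R \<omega>) \<omega>)\<^sup>2)"
    by (rule integral_indep_index_nonneg[OF ind sp _ R(1), where g="\<lambda>n \<omega>. (U n \<omega>)\<^sup>2"])
      (use iU U eU2 iR R2 in auto)
  have "expectation (\<lambda>\<omega>. U (R \<omega>) \<omega>) = expectation (\<lambda>\<omega>. expectation (U (R \<omega>)))"
  \<comment> \<open>The dominating function is chosen quadratic because the second moments of
    \<open>U\<close> and of \<open>R\<close> are the ones under control: its expectation at a frozen
    n is a quadratic polynomial in n.\<close>
  proof (rule integral_indep_index(2)[OF ind sp U _ R(1), where q="\<lambda>n \<omega>. 1 + (U n \<omega>)\<^sup>2"])
    show "\<bar>U j \<omega>\<bar> \<le> 1 + (U j \<omega>)\<^sup>2" for j \<omega>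
    proof -
      have "0 \<le> (\<bar>U j \<omega>\<bar> - 1)\<^sup>2" by simp
      then have "2 * \<bar>U j \<omega>\<bar> \<le> 1 + (U j \<omega>)\<^sup>2" by (simp add: power2_diff)
      then show ?thesis by linarith
    qed
    have "expectation (\<lambda>x. 1 + (U n x)\<^sup>2) = 1 + (v * real n + a\<^sup>2 * (real n)\<^sup>2)" for n
      using iU eU2 by (simp add: prob_space)
    then show "integrable M (\<lambda>\<omega>. expectation (\<lambda>x. 1 + (U (R \<omega>) x)\<^sup>2))"
      using iR R2 by simp
  qed (use iU U in auto)
  then show "expectation (\<lambda>\<omega>. U (R \<omega>) \<omega>) = a * expectation (\<lambda>\<omega>. real (R \<omega>))"
    using iR by (simp add: eU)
  \<comment> \<open>The product involves two indices at once; the pair still lies in a countable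
    type, so the same rule applies.\<close>
  let ?J = "\<lambda>\<omega>. (R \<omega>, R' \<omega>)"
  let ?g = "\<lambda>j \<omega>. U (fst j) \<omega> * U (snd j) \<omega>"
  let ?q = "\<lambda>j \<omega>. (U (fst j) \<omega>)\<^sup>2 + (U (snd j) \<omega>)\<^sup>2"
  have "expectation (\<lambda>\<omega>. ?g (?J \<omega>) \<omega>) = expectation (\<lambda>\<omega>. expectation (?g (?J \<omega>)))"
  proof (rule integral_indep_index(2)[OF ind sp, where g="?g" and q="?q" and J="?J"])
    show "?J \<in> measurable G (count_space UNIV)" by measurable
    show "\<bar>?g j \<omega>\<bar> \<le> ?q j \<omega>" for j \<omega>
    proof -
      have "0 \<le> (\<bar>U (fst j) \<omega>\<bar> - \<bar>U (snd j) \<omega>\<bar>)\<^sup>2" by simp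
      then have "2 * \<bar>?g j \<omega>\<bar> \<le> ?q j \<omega>" by (simp add: power2_diff abs_mult)
      then show ?thesis by linarith
    qed
    show "integrable M (\<lambda>\<omega>. expectation (?q (?J \<omega>)))"
      using iR R2 iU by (simp add: eU2)
  qed (use iU U in auto)
  also have "\<dots> = expectation (\<lambda>\<omega>. v * real (min (R \<omega>) (R' \<omega>)) + a\<^sup>2 * (real (R \<omega>) * real (R' \<omega>)))"
    by (simp add: eUU mult.assoc)
  also have "\<dots> = v * expectation (\<lambda>\<omega>. real (min (R \<omega>) (R' \<omega>))) + a\<^sup>2 * expectation (\<lambda>\<omega>. real (R \<omega>) * real (R' \<omega>))"
    using imin iRR by simp
  finally show "expectation (\<lambda>\<omega>. U (R \<omega>) \<omega> * U (R' \<omega>) \<omega>) =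
      v * expectation (\<lambda>\<omega>. real (min (R \<omega>) (R' \<omega>))) + a\<^sup>2 * expectation (\<lambda>\<omega>. real (R \<omega>) * real (R' \<omega>))"
    by simp
qed

text \<open>Monotonicity of the clock is what keeps the structure: almost surely the minimum of two
  clock values is the clock at the earlier time, so its expectation is \<open>b\<close> times the
  minimum of the times. The product moment of the clock contributes the extra rate
  \<open>a\<^sup>2 * w\<close> and the product of the new means.\<close>

lemma linear_moments_compose:
  fixes U :: "nat \<Rightarrow> 'a \<Rightarrow> real" and R :: "'i \<Rightarrow> 'a \<Rightarrow> nat"
  assumes ind: "indep_set (sets F) (sets G)" and sp: "space F = space M" "space G = space M"
    and U: "\<And>n. U n \<in> borel_measurable F"
    and R: "\<And>i. i \<in> T \<Longrightarrow> R i \<in> measurable G (count_space UNIV)"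
    and linU: "linear_moments a v UNIV real U"
    and linR: "linear_moments b w T \<tau> (\<lambda>i \<omega>. real (R i \<omega>))"
    and mono: "\<And>i j. i \<in> T \<Longrightarrow> j \<in> T \<Longrightarrow> \<tau> i \<le> \<tau> j \<Longrightarrow> AE \<omega> in M. R i \<omega> \<le> R j \<omega>"
  shows "linear_moments (a * b) (v * b + a\<^sup>2 * w) T \<tau> (\<lambda>i \<omega>. U (R i \<omega>) \<omega>)"
proof -
  have subG: "sets G \<subseteq> events" using ind by (auto simp: indep_sets2_eq)
  have mR: "R i \<in> measurable M (count_space UNIV)" if "i \<in> T" for i
    using R[OF that] subG sp by (auto simp: measurable_def)
  have R2: "integrable M (\<lambda>\<omega>. (real (R i \<omega>))\<^sup>2)" if "i \<in> T" for i
    using linR that by (auto simp: linear_moments_def)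
  have eR: "expectation (\<lambda>\<omega>. real (R i \<omega>)) = b * \<tau> i" if "i \<in> T" for i
    using linR that by (auto simp: linear_moments_def)
  have eRR: "expectation (\<lambda>\<omega>. real (R i \<omega>) * real (R j \<omega>)) = w * min (\<tau> i) (\<tau> j) + b\<^sup>2 * \<tau> i * \<tau> j"
    if "i \<in> T" "j \<in> T" for i j
    using linR that by (auto simp: linear_moments_def)
  have le: "expectation (\<lambda>\<omega>. real (min (R i \<omega>) (R j \<omega>))) = b * \<tau> i"
    if "i \<in> T" "j \<in> T" "\<tau> i \<le> \<tau> j" for i j
  proof -
    note [measurable] = mR[OF that(1)] mR[OF that(2)]
    have "expectation (\<lambda>\<omega>. real (min (R i \<omega>) (R j \<omega>))) = expectation (\<lambda>\<omega>. real (R i \<omega>))"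
      by (rule integral_cong_AE) (use mono[OF that] in \<open>auto simp: min_def\<close>)
    then show ?thesis using eR that by simp
  qed
  have emin: "expectation (\<lambda>\<omega>. real (min (R i \<omega>) (R j \<omega>))) = b * min (\<tau> i) (\<tau> j)"
    if "i \<in> T" "j \<in> T" for i j
  proof (cases "\<tau> i \<le> \<tau> j")
    case True then show ?thesis using le that by (simp add: min_def)
  next
    case False
    have "(\<lambda>\<omega>. real (min (R i \<omega>) (R j \<omega>))) = (\<lambda>\<omega>. real (min (R j \<omega>) (R i \<omega>)))"
      by (simp add: min.commute)
    with False show ?thesis using le[of j i] that by simp
  qed
  note m = indep_index_moments[OF ind sp U R R linU R2 R2]
  show ?thesis unfolding linear_moments_def
  proof (intro conjI ballI)
    fix i j assume ij: "i \<in> T" "j \<in> T"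
    show "(\<lambda>\<omega>. U (R i \<omega>) \<omega>) \<in> borel_measurable M" using m(1)[OF ij(1) ij(1) ij(1) ij(1)] .
    show "integrable M (\<lambda>\<omega>. (U (R i \<omega>) \<omega>)\<^sup>2)" using m(2)[OF ij(1) ij(1) ij(1) ij(1)] .
    show "expectation (\<lambda>\<omega>. U (R i \<omega>) \<omega>) = a * b * \<tau> i"
      using m(3)[OF ij(1) ij(1) ij(1) ij(1)] eR ij by simp
    show "expectation (\<lambda>\<omega>. U (R i \<omega>) \<omega> * U (R j \<omega>) \<omega>) =
      (v * b + a\<^sup>2 * w) * min (\<tau> i) (\<tau> j) + (a * b)\<^sup>2 * \<tau> i * \<tau> j"
      unfolding m(4)[OF ij ij] emin[OF ij] eRR[OF ij] by (simp add: algebra_simps power2_eq_square)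
  qed
qed

end

section \<open>Moments of Levy processes and of walks\<close>

text \<open>Cauchy's functional equation, with nonnegativity in place of continuity: it makes f
  monotone. Comparing \<open>n * t\<close> with the integers m and m + 1 around it bounds
  \<open>n\<close> times the defect by \<open>f 1\<close> for every n, so the defect is zero. Means
  and variances of Levy processes are of this kind.\<close>

lemma additive_nonneg_linear:
  fixes f :: "real \<Rightarrow> real"
  assumes add: "\<And>s t. 0 \<le> s \<Longrightarrow> 0 \<le> t \<Longrightarrow> f (s + t) = f s + f t"
    and nn: "\<And>t. 0 \<le> t \<Longrightarrow> 0 \<le> f t" and t: "0 \<le> t"
  shows "f t = f 1 * t"
proof -
  have mul: "f (real n * x) = real n * f x" if "0 \<le> x" for n x
  proof (induction n)
    case 0 then show ?case using add[of 0 0] by simp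
  next
    case (Suc n) then show ?case using add[of "real n * x" x] that by (simp add: distrib_right add.commute)
  qed
  have mono: "f x \<le> f y" if "0 \<le> x" "x \<le> y" for x y
    using add[of x "y - x"] nn[of "y - x"] that by simp
  have bound: "real n * \<bar>f t - f 1 * t\<bar> \<le> f 1" for n
  proof -
    define m where "m = nat \<lfloor>real n * t\<rfloor>"
    have m: "real m \<le> real n * t" "real n * t \<le> real (Suc m)"
      using t unfolding m_def by (simp_all add: of_nat_nat, linarith)
    have "real m * f 1 \<le> real n * f t" "real n * f t \<le> real (Suc m) * f 1"
      using mono[OF _ m(1)] mono[OF _ m(2)] mul[of 1 m] mul[of 1 "Suc m"] mul[OF t, of n] t by auto
    moreover have "real m * f 1 \<le> real n * t * f 1" "real n * t * f 1 \<le> real (Suc m) * f 1"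
      using m nn[of 1] by (auto intro!: mult_right_mono)
    ultimately have "\<bar>real n * f t - real n * t * f 1\<bar> \<le> f 1"
      by (simp add: distrib_right abs_le_iff)
    also have "real n * f t - real n * t * f 1 = real n * (f t - f 1 * t)"
      by (simp add: algebra_simps)
    finally show ?thesis by (simp add: abs_mult)
  qed
  have "\<bar>f t - f 1 * t\<bar> = 0"
  proof (rule ccontr)
    assume "\<bar>f t - f 1 * t\<bar> \<noteq> 0"
    then have "0 < \<bar>f t - f 1 * t\<bar>" by simp
    from reals_Archimedean3[OF this] obtain n where "f 1 < real n * \<bar>f t - f 1 * t\<bar>" by blast
    with bound[of n] show False by simp
  qed
  then show ?thesis by simp
qed

context prob_space
begin

text \<open>Stationary increments make the mean additive, and independent ones make the variance
  additive; both are nonnegative, hence linear in time. Monotonicity holds because the increment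
  from s to t has the law of \<open>X (t - s)\<close>, which is carried by the nonnegative
  reals.\<close>

lemma levy_process_moments:
  assumes X: "levy_process X"
    and sq: "\<And>t. 0 \<le> t \<Longrightarrow> integrable M (\<lambda>\<omega>. (X t \<omega>)\<^sup>2)"
    and nn: "\<And>t. 0 \<le> t \<Longrightarrow> AE \<omega> in M. 0 \<le> X t \<omega>"
  shows "linear_moments (expectation (X 1)) (variance (X 1)) {0..} (\<lambda>t. t) X"
    and "\<And>s t. 0 \<le> s \<Longrightarrow> s \<le> t \<Longrightarrow> AE \<omega> in M. X s \<omega> \<le> X t \<omega>"
proof -
  have m: "X t \<in> borel_measurable M" if "0 \<le> t" for t
    using X that by (auto simp: levy_process_def)
  have m0 [measurable]: "X 0 \<in> borel_measurable M" using m by simp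
  have z: "AE \<omega> in M. X 0 \<omega> = 0" using X by (auto simp: levy_process_def)
  have int: "integrable M (X t)" if "0 \<le> t" for t
    using integrable_of_square[OF m sq] that by simp
  have prod: "integrable M (\<lambda>\<omega>. X s \<omega> * X t \<omega>)" if "0 \<le> s" "0 \<le> t" for s t
    using integrable_prod_of_squares[OF m m sq sq] that by simp
  have law: "distr M borel (\<lambda>\<omega>. X (s + h) \<omega> - X s \<omega>) = distr M borel (X h)" if "0 \<le> s" "0 \<le> h" for s h
  proof -
    note [measurable] = m[OF that(2)]
    have "distr M borel (\<lambda>\<omega>. X (s + h) \<omega> - X s \<omega>) = distr M borel (\<lambda>\<omega>. X h \<omega> - X 0 \<omega>)"
      using X that by (auto simp: levy_process_def stationary_increments_def)
    also have "\<dots> = distr M borel (X h)"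
      \<comment> \<open>\<open>X 0\<close> vanishes only almost surely, so equality is claimed for
        the laws and not for the functions.\<close>
      by (rule distr_cong_AE) (use z in auto)
    finally show ?thesis .
  qed
  have incr: "expectation (\<lambda>\<omega>. g (X (s + h) \<omega> - X s \<omega>)) = expectation (\<lambda>\<omega>. g (X h \<omega>))"
    if "0 \<le> s" "0 \<le> h" "g \<in> borel_measurable borel" for s h and g :: "real \<Rightarrow> real"
  proof -
    have "0 \<le> s + h" using that by simp
    note [measurable] = m[OF that(1)] m[OF that(2)] m[OF this] that(3)
    have "expectation (\<lambda>\<omega>. g (X (s + h) \<omega> - X s \<omega>)) = integral\<^sup>L (distr M borel (\<lambda>\<omega>. X (s + h) \<omega> - X s \<omega>)) g"
      by (rule integral_distr[symmetric]) auto
    also have "\<dots> = integral\<^sup>L (distr M borel (X h)) g" using law[OF that(1,2)] by simp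
    also have "\<dots> = expectation (\<lambda>\<omega>. g (X h \<omega>))" by (rule integral_distr) auto
    finally show ?thesis .
  qed
  show mono: "AE \<omega> in M. X s \<omega> \<le> X t \<omega>" if "0 \<le> s" "s \<le> t" for s t
  proof -
    have st: "0 \<le> t" "0 \<le> t - s" using that by auto
    have ts: "s + (t - s) = t" by simp
    note [measurable] = m[OF that(1)] m[OF st(1)] m[OF st(2)]
    have "AE x in distr M borel (X (t - s)). 0 \<le> x"
      using nn[OF st(2)] by (subst AE_distr_iff) auto
    then have "AE x in distr M borel (\<lambda>\<omega>. X t \<omega> - X s \<omega>). 0 \<le> x"
      unfolding law[OF that(1) st(2), unfolded ts] .
    then show ?thesis by (subst (asm) AE_distr_iff) auto
  qed
  let ?f = "\<lambda>t. expectation (X t)"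
  let ?q = "\<lambda>t. expectation (\<lambda>\<omega>. (X t \<omega>)\<^sup>2)"
  have fadd: "?f (s + h) = ?f s + ?f h" if "0 \<le> s" "0 \<le> h" for s h
    using incr[OF that, of "\<lambda>x. x"] int that by simp
  have f: "?f t = ?f 1 * t" if "0 \<le> t" for t
    by (rule additive_nonneg_linear[where f="?f"]) (use fadd nn that in \<open>auto intro: integral_nonneg_AE\<close>)
  have ind: "expectation (\<lambda>\<omega>. X s \<omega> * (X (s + h) \<omega> - X s \<omega>)) = ?f s * ?f h"
    if "0 \<le> s" "0 \<le> h" for s h
  proof -
    have sh: "0 \<le> s + h" using that by simp
    note [measurable] = m[OF that(1)] m[OF sh]
    \<comment> \<open>Independence is postulated for increments along a partition. The points 0, s,
      s + h present \<open>X s\<close> as the first increment, up to the null set where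
      \<open>X 0\<close> is not zero.\<close>
    define p where "p i = (if i = 0 then 0 else if i = 1 then s else s + h)" for i :: nat
    define D where "D i = (\<lambda>\<omega>. X (p (Suc i)) \<omega> - X (p i) \<omega>)" for i
    have "indep_vars (\<lambda>_. borel) D {..<2}"
    proof -
      have "0 \<le> p 0" "\<forall>i<2. p i \<le> p (Suc i)" using that by (auto simp: p_def)
      then show ?thesis
        using X unfolding levy_process_def independent_increments_def D_def by blast
    qed
    moreover have "integrable M (D i)" if "i \<in> {..<2}" for i
      using that int sh \<open>0 \<le> s\<close> by (auto simp: D_def p_def)
    ultimately have "expectation (\<lambda>\<omega>. \<Prod>i\<in>{..<2}. D i \<omega>) = (\<Prod>i\<in>{..<2}. expectation (D i))"
      by (intro indep_vars_lebesgue_integral) auto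
    then have "expectation (\<lambda>\<omega>. D 0 \<omega> * D 1 \<omega>) = expectation (D 0) * expectation (D 1)"
      by (simp add: numeral_2_eq_2)
    moreover have "expectation (\<lambda>\<omega>. D 0 \<omega> * D 1 \<omega>) = expectation (\<lambda>\<omega>. X s \<omega> * (X (s + h) \<omega> - X s \<omega>))"
      unfolding D_def p_def by (rule integral_cong_AE) (use z in \<open>auto simp: p_def\<close>)
    moreover have "expectation (D 0) = ?f s"
      unfolding D_def p_def by (rule integral_cong_AE) (use z in \<open>auto simp: p_def\<close>)
    moreover have "expectation (D 1) = ?f h"
      using incr[OF that, of "\<lambda>x. x"] by (simp add: D_def p_def)
    ultimately show ?thesis by simp
  qed
  have cross: "expectation (\<lambda>\<omega>. X s \<omega> * X (s + h) \<omega>) = ?q s + ?f s * ?f h" if "0 \<le> s" "0 \<le> h" for s h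
  proof -
    have "expectation (\<lambda>\<omega>. X s \<omega> * (X (s + h) \<omega> - X s \<omega>)) = expectation (\<lambda>\<omega>. X s \<omega> * X (s + h) \<omega> - X s \<omega> * X s \<omega>)"
      by (simp add: algebra_simps)
    also have "\<dots> = expectation (\<lambda>\<omega>. X s \<omega> * X (s + h) \<omega>) - expectation (\<lambda>\<omega>. X s \<omega> * X s \<omega>)"
      by (rule Bochner_Integration.integral_diff) (use prod that in auto)
    finally show ?thesis using ind[OF that] by (simp add: power2_eq_square)
  qed
  have q: "?q (s + h) = ?q s + 2 * (?f s * ?f h) + ?q h" if "0 \<le> s" "0 \<le> h" for s h
  proof -
    have "?q h = expectation (\<lambda>\<omega>. (X (s + h) \<omega> - X s \<omega>)\<^sup>2)"
      using incr[OF that, of "\<lambda>x. x\<^sup>2"] by simp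
    also have "\<dots> = expectation (\<lambda>\<omega>. (X (s + h) \<omega>)\<^sup>2 + (X s \<omega>)\<^sup>2 - 2 * (X s \<omega> * X (s + h) \<omega>))"
      by (intro Bochner_Integration.integral_cong) (auto simp: power2_eq_square algebra_simps)
    also have "\<dots> = ?q (s + h) + ?q s - 2 * expectation (\<lambda>\<omega>. X s \<omega> * X (s + h) \<omega>)"
      using sq prod that by simp
    finally show ?thesis using cross[OF that] by simp
  qed
  have var: "variance (X t) = ?q t - (?f t)\<^sup>2" if "0 \<le> t" for t
    using variance_eq[OF int sq] that by simp
  have v: "variance (X t) = variance (X 1) * t" if "0 \<le> t" for t
  proof (rule additive_nonneg_linear[where f="\<lambda>t. variance (X t)", OF _ variance_positive that])
    fix s h :: real assume sh: "0 \<le> s" "0 \<le> h"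
    then have "0 \<le> s + h" by simp
    show "variance (X (s + h)) = variance (X s) + variance (X h)"
      unfolding var[OF sh(1)] var[OF sh(2)] var[OF \<open>0 \<le> s + h\<close>]
      unfolding q[OF sh] fadd[OF sh] by (simp add: power2_sum)
  qed
  have qq: "?q t = variance (X 1) * t + (?f 1)\<^sup>2 * t * t" if "0 \<le> t" for t
    using v[OF that] var[OF that] f[OF that] by (simp add: power2_eq_square)
  have le: "expectation (\<lambda>\<omega>. X s \<omega> * X t \<omega>) = variance (X 1) * s + (?f 1)\<^sup>2 * s * t" if "0 \<le> s" "s \<le> t" for s t
  proof -
    have "0 \<le> t - s" "s + (t - s) = t" using that by auto
    then have "expectation (\<lambda>\<omega>. X s \<omega> * X t \<omega>) = ?q s + (?f 1 * s) * (?f 1 * (t - s))"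
      using cross[OF that(1), of "t - s"] f[OF that(1)] f[of "t - s"] by simp
    then show ?thesis unfolding qq[OF that(1)] by (simp add: power2_eq_square algebra_simps)
  qed
  have all: "expectation (\<lambda>\<omega>. X s \<omega> * X t \<omega>) = variance (X 1) * min s t + (?f 1)\<^sup>2 * s * t" if "0 \<le> s" "0 \<le> t" for s t
  proof (cases "s \<le> t")
    case True then show ?thesis using le[OF that(1) True] by (simp add: min_def)
  next
    case False
    then have "expectation (\<lambda>\<omega>. X t \<omega> * X s \<omega>) = variance (X 1) * t + (?f 1)\<^sup>2 * t * s"
      using that by (intro le) auto
    moreover have "min s t = t" using False by simp
    ultimately show ?thesis by (simp only: mult.assoc mult.commute[of t s] mult.commute[of "X t _"])
  qed
  show "linear_moments (expectation (X 1)) (variance (X 1)) {0..} (\<lambda>t. t) X"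
    unfolding linear_moments_def
    by (intro conjI ballI all f m sq) simp_all
qed

text \<open>In the double sum every pair of steps contributes \<open>a\<^sup>2\<close>, and each
  diagonal pair an excess \<open>q - a\<^sup>2\<close>. There are \<open>min n k\<close> diagonal
  pairs, which is the origin of the minimum in \<open>linear_moments\<close>.\<close>

lemma iid_walk_moments:
  assumes ind: "indep_vars (\<lambda>_. borel) Y {1..}"
    and sq: "\<And>i. 1 \<le> i \<Longrightarrow> integrable M (\<lambda>\<omega>. (Y i \<omega>)\<^sup>2)"
    and e: "\<And>i. 1 \<le> i \<Longrightarrow> expectation (Y i) = a"
    and q: "\<And>i. 1 \<le> i \<Longrightarrow> expectation (\<lambda>\<omega>. (Y i \<omega>)\<^sup>2) = q"
  shows "linear_moments a (q - a\<^sup>2) UNIV real (\<lambda>n \<omega>. \<Sum>i = 1..n. Y i (\<omega> :: 'a) :: real)"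
proof -
  have m: "Y i \<in> borel_measurable M" if "1 \<le> i" for i
    using ind that by (auto simp: indep_vars_def)
  have int: "integrable M (Y i)" if "1 \<le> i" for i
    using integrable_of_square[OF m sq] that by simp
  have prod: "integrable M (\<lambda>\<omega>. Y i \<omega> * Y j \<omega>)" if "1 \<le> i" "1 \<le> j" for i j
    using integrable_prod_of_squares[OF m m sq sq] that by simp
  have E: "expectation (\<lambda>\<omega>. Y i \<omega> * Y j \<omega>) = a\<^sup>2 + (if i = j then q - a\<^sup>2 else 0)"
    if "1 \<le> i" "1 \<le> j" for i j
  proof (cases "i = j")
    case True then show ?thesis using q[OF that(1)] by (simp add: power2_eq_square)
  next
    case False
    \<comment> \<open>The index set \<open>{i,j}\<close> yields two separate factors only because i
      and j differ in this case.\<close>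
    have "expectation (\<lambda>\<omega>. \<Prod>l\<in>{i,j}. Y l \<omega>) = (\<Prod>l\<in>{i,j}. expectation (Y l))"
      by (rule indep_vars_lebesgue_integral)
        (use that int in \<open>auto intro: indep_vars_subset[OF ind]\<close>)
    then show ?thesis using False e that by (simp add: power2_eq_square)
  qed
  have sums: "(\<lambda>\<omega>. (\<Sum>i = 1..n. Y i \<omega>) * (\<Sum>j = 1..k. Y j \<omega>)) = (\<lambda>\<omega>. \<Sum>i = 1..n. \<Sum>j = 1..k. Y i \<omega> * Y j \<omega>)" for n k
    by (simp add: sum_product)
  have iprod: "integrable M (\<lambda>\<omega>. (\<Sum>i = 1..n. Y i \<omega>) * (\<Sum>j = 1..k. Y j \<omega>))" for n k
    unfolding sums by (intro Bochner_Integration.integrable_sum prod) auto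
  have "expectation (\<lambda>\<omega>. (\<Sum>i = 1..n. Y i \<omega>) * (\<Sum>j = 1..k. Y j \<omega>)) = (q - a\<^sup>2) * min (real n) (real k) + a\<^sup>2 * real n * real k" for n k
  proof -
    have "expectation (\<lambda>\<omega>. (\<Sum>i = 1..n. Y i \<omega>) * (\<Sum>j = 1..k. Y j \<omega>))
      = (\<Sum>i = 1..n. \<Sum>j = 1..k. expectation (\<lambda>\<omega>. Y i \<omega> * Y j \<omega>))"
      unfolding sums using prod by (subst Bochner_Integration.integral_sum, force)+ simp
    also have "\<dots> = (\<Sum>i = 1..n. \<Sum>j = 1..k. a\<^sup>2 + (if i = j then q - a\<^sup>2 else 0))"
      by (intro sum.cong refl E) auto
    also have "\<dots> = a\<^sup>2 * real n * real k + (\<Sum>i = 1..n. if i \<le> k then q - a\<^sup>2 else 0)"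
      by (simp add: sum.distrib mult.commute mult.left_commute)
    also have "(\<Sum>i = 1..n. if i \<le> k then q - a\<^sup>2 else 0) = (\<Sum>i \<in> {1..min n k}. q - a\<^sup>2)"
      by (rule sum.mono_neutral_cong_right) auto
    finally show ?thesis by (simp add: of_nat_min mult.commute)
  qed
  moreover have "integrable M (\<lambda>\<omega>. (\<Sum>i = 1..n. Y i \<omega>)\<^sup>2)" for n
    using iprod[of n n] by (simp add: power2_eq_square)
  moreover have "expectation (\<lambda>\<omega>. \<Sum>i = 1..n. Y i \<omega>) = a * real n" for n
    using int e by (subst Bochner_Integration.integral_sum) auto
  moreover have "(\<lambda>\<omega>. \<Sum>i = 1..n. Y i \<omega>) \<in> borel_measurable M" for n
    using m by (intro borel_measurable_sum) auto
  ultimately show ?thesis by (simp add: linear_moments_def)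
qed

section \<open>Independent families, and Poisson processes of order k\<close>

lemma indep_set_commute: "indep_set A B \<longleftrightarrow> indep_set B A"
  unfolding indep_sets2_eq by (metis Int_commute mult.commute)

text \<open>A coordinate is the projection of the whole family. This links
  \<open>indep_families\<close>, whose sigma-algebras are pulled back from a product space, to the
  coordinatewise measurability required for freezing an index.\<close>

lemma measurable_family_vimage:
  assumes "\<And>i. i \<in> I \<Longrightarrow> X i \<in> measurable M B" and "i \<in> I"
  shows "X i \<in> measurable (vimage_algebra (space M) (\<lambda>\<omega>. \<lambda>i\<in>I. X i \<omega>) (\<Pi>\<^sub>M i\<in>I. B)) B"
proof -
  have "(\<lambda>\<omega>. \<lambda>i\<in>I. X i \<omega>) \<in> space M \<rightarrow> space (\<Pi>\<^sub>M i\<in>I. B)"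
    using measurable_space[OF assms(1)] by (auto simp: space_PiM)
  from measurable_vimage_algebra1[OF this]
  have "(\<lambda>\<omega>. (\<lambda>i\<in>I. X i \<omega>) i) \<in> measurable (vimage_algebra (space M) (\<lambda>\<omega>. \<lambda>i\<in>I. X i \<omega>) (\<Pi>\<^sub>M i\<in>I. B)) B"
    using assms(2) by (rule measurable_compose[OF _ measurable_component_singleton])
  then show ?thesis using assms(2) by simp
qed

text \<open>From \<open>n < 2 ^ n\<close> the square is at most \<open>4 ^ n\<close>, so the series
  is dominated by a multiple of the exponential series at \<open>4 * \<rho>\<close>.\<close>

lemma poisson_second_moment:
  assumes "0 < (\<rho>::real)"
  shows "integrable (measure_pmf (poisson_pmf \<rho>)) (\<lambda>n. (real n)\<^sup>2)"
proof -
  have "summable (\<lambda>n. \<rho> ^ n / fact n * exp (-\<rho>) * (real n)\<^sup>2)"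
  proof (rule summable_comparison_test)
    have le: "(real n)\<^sup>2 \<le> 4 ^ n" for n
    proof -
      have "real n \<le> 2 ^ n" using of_nat_less_two_power[of n, where 'a=real] by simp
      then have "(real n)\<^sup>2 \<le> (2 ^ n)\<^sup>2" by (intro power_mono) auto
      then show ?thesis by (simp add: power2_eq_square flip: power_mult_distrib)
    qed
    have "norm (\<rho> ^ n / fact n * exp (-\<rho>) * (real n)\<^sup>2) \<le> exp (-\<rho>) * (inverse (fact n) * (4 * \<rho>) ^ n)" for n
    proof -
      have "\<rho> ^ n / fact n * exp (-\<rho>) * (real n)\<^sup>2 \<le> \<rho> ^ n / fact n * exp (-\<rho>) * 4 ^ n"
        using assms by (intro mult_left_mono le) auto
      then show ?thesis using assms by (simp add: power_mult_distrib field_simps)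
    qed
    then show "\<exists>m. \<forall>n\<ge>m. norm (\<rho> ^ n / fact n * exp (-\<rho>) * (real n)\<^sup>2) \<le> exp (-\<rho>) * (inverse (fact n) * (4 * \<rho>) ^ n)"
      by blast
    show "summable (\<lambda>n. exp (-\<rho>) * (inverse (fact n) * (4 * \<rho>) ^ n))"
      by (intro summable_mult summable_exp)
  qed
  then have "integrable (count_space UNIV) (\<lambda>n. pmf (poisson_pmf \<rho>) n *\<^sub>R (real n)\<^sup>2)"
    using assms by (simp add: integrable_count_space_nat_iff)
  then show ?thesis
    unfolding measure_pmf_eq_density by (subst integrable_density) auto
qed

text \<open>A Levy process is real valued, so the definition yields measurability only of the
  embedded values; the floor undoes the embedding.\<close>

lemma poisson_process_measurable:
  assumes "poisson_process \<rho> N" "0 \<le> t"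
  shows "N t \<in> measurable M (count_space UNIV)"
proof -
  have [measurable]: "(\<lambda>\<omega>. real (N t \<omega>)) \<in> borel_measurable M"
    using assms by (auto simp: poisson_process_def levy_process_def)
  have "(\<lambda>\<omega>. nat \<lfloor>real (N t \<omega>)\<rfloor>) \<in> measurable M (count_space UNIV)" by measurable
  then show ?thesis by simp
qed

text \<open>Only the signs of the rates matter later. Both are strict because the Poisson law at
  time 1 charges 0 as well as 1, so that \<open>N 1\<close> is not almost surely constant; a
  vanishing mean or variance would make it so.\<close>

lemma poisson_process_moments:
  assumes N: "poisson_process \<rho> N" and \<rho>: "0 < \<rho>"
  obtains b w where "0 < b" "0 < w" "linear_moments b w {0..} (\<lambda>t. t) (\<lambda>t \<omega>. real (N t \<omega>))"
    "\<And>s t. 0 \<le> s \<Longrightarrow> s \<le> t \<Longrightarrow> AE \<omega> in M. N s \<omega> \<le> N t \<omega>"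
proof -
  let ?X = "\<lambda>t \<omega>. real (N t \<omega>)"
  have L: "levy_process ?X" using N by (simp add: poisson_process_def)
  have D: "distr M (count_space UNIV) (N t) = measure_pmf (poisson_pmf (\<rho> * t))" if "0 < t" for t
    using N that by (simp add: poisson_process_def)
  have mN: "N t \<in> measurable M (count_space UNIV)" if "0 \<le> t" for t
    using poisson_process_measurable[OF N that] .
  have sq: "integrable M (\<lambda>\<omega>. (?X t \<omega>)\<^sup>2)" if "0 \<le> t" for t
  proof (cases "t = 0")
    \<comment> \<open>The Poisson law is prescribed for positive times only; at time 0 the value is
      almost surely 0 by the Levy property.\<close>
    case True
    have [measurable]: "N 0 \<in> measurable M (count_space UNIV)" using mN by simp
    have "integrable M (\<lambda>\<omega>. (?X 0 \<omega>)\<^sup>2) \<longleftrightarrow> integrable M (\<lambda>\<omega>. 0::real)"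
      by (rule integrable_cong_AE) (use L in \<open>auto simp: levy_process_def\<close>)
    then show ?thesis using True by simp
  next
    case False
    then have t: "0 < t" using that by simp
    have "integrable (distr M (count_space UNIV) (N t)) (\<lambda>n. (real n)\<^sup>2)"
      unfolding D[OF t] using poisson_second_moment[of "\<rho> * t"] \<rho> t by simp
    then show ?thesis using mN[OF that] by (subst (asm) integrable_distr_eq) auto
  qed
  note mom = levy_process_moments[OF L sq, simplified]
  have AE1: "AE n in measure_pmf (poisson_pmf \<rho>). P n" if "AE \<omega> in M. P (N 1 \<omega>)" for P
    using that mN[of 1] unfolding D[of 1, simplified, symmetric] by (subst AE_distr_iff) auto
  have no_const: False if "AE \<omega> in M. ?X 1 \<omega> = c" for c
  proof -
    have "AE n in measure_pmf (poisson_pmf \<rho>). real n = c" using AE1 that by simp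
    then have "\<forall>n. real n = c" using \<rho> by (simp add: AE_measure_pmf_iff)
    from this[rule_format, of 0] this[rule_format, of 1] show False by simp
  qed
  have i2: "integrable M (\<lambda>\<omega>. (?X 1 \<omega>)\<^sup>2)" using sq by simp
  have i: "integrable M (?X 1)"
    by (rule integrable_of_square[OF _ i2]) (use mN[of 1] in simp)
  have "expectation (?X 1) \<noteq> 0"
    using integral_nonneg_eq_0_iff_AE[OF i] no_const[of 0] by auto
  moreover have "0 \<le> expectation (?X 1)" by simp
  moreover have "variance (?X 1) \<noteq> 0"
  proof
    assume "variance (?X 1) = 0"
    moreover have "integrable M (\<lambda>\<omega>. (?X 1 \<omega> - expectation (?X 1))\<^sup>2)"
      using i i2 by (simp add: power2_diff)
    ultimately have "AE \<omega> in M. (?X 1 \<omega> - expectation (?X 1))\<^sup>2 = 0"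
      by (subst (asm) integral_nonneg_eq_0_iff_AE) auto
    then show False using no_const[of "expectation (?X 1)"] by simp
  qed
  moreover have "0 \<le> variance (?X 1)" by simp
  ultimately have "0 < expectation (?X 1)" "0 < variance (?X 1)" by linarith+
  moreover have "AE \<omega> in M. N s \<omega> \<le> N t \<omega>" if "0 \<le> s" "s \<le> t" for s t
    using mom(2)[OF that] by simp
  ultimately show ?thesis using that[OF _ _ mom(1)] by blast
qed

text \<open>Strict positivity of the variance rate must come from \<open>a\<^sup>2 * w\<close>: for
  k = 1 the steps are constant and \<open>q - a\<^sup>2\<close> is zero. The mean step is at least
  1, since the steps take values in \<open>{1..k}\<close>; their nonnegativity also makes the new
  process inherit monotonicity from \<open>N\<close>.\<close>

lemma ppok_moments:
  assumes P: "ppok k r Nk" and k: "1 \<le> k" and r: "0 < r"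
  obtains b w where "0 < b" "0 < w" "linear_moments b w {0..} (\<lambda>t. t) (\<lambda>t \<omega>. real (Nk t \<omega>))"
    "\<And>s t. 0 \<le> s \<Longrightarrow> s \<le> t \<Longrightarrow> AE \<omega> in M. Nk s \<omega> \<le> Nk t \<omega>"
proof -
  obtain N X where N: "poisson_process (real k * r) N"
    and X: "indep_vars (\<lambda>_. count_space UNIV) X {1..}"
    and DX: "\<And>i. i \<ge> 1 \<Longrightarrow> distr M (count_space UNIV) (X i) = measure_pmf (pmf_of_set {1..k})"
    and ind: "indep_families {0..} (count_space UNIV) N {1..} (count_space UNIV) X"
    and eq: "\<And>t \<omega>. t \<ge> 0 \<Longrightarrow> \<omega> \<in> space M \<Longrightarrow> Nk t \<omega> = (\<Sum>i = 1..N t \<omega>. X i \<omega>)"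
    using P unfolding ppok_def by blast
  obtain b w where bw: "0 < b" "0 < w" and LN: "linear_moments b w {0..} (\<lambda>t. t) (\<lambda>t \<omega>. real (N t \<omega>))"
    and mono: "\<And>s t. 0 \<le> s \<Longrightarrow> s \<le> t \<Longrightarrow> AE \<omega> in M. N s \<omega> \<le> N t \<omega>"
    using poisson_process_moments[OF N] k r by auto
  have fin: "set_pmf (pmf_of_set {1..k}) = {1..k}" using k by (intro set_pmf_of_set) auto
  have mX: "X i \<in> measurable M (count_space UNIV)" if "1 \<le> i" for i
    using X that by (auto simp: indep_vars_def)
  have sq: "integrable M (\<lambda>\<omega>. (real (X i \<omega>))\<^sup>2)" if "1 \<le> i" for i
  proof -
    have "integrable (distr M (count_space UNIV) (X i)) (\<lambda>n. (real n)\<^sup>2)"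
      unfolding DX[OF that] by (rule integrable_measure_pmf_finite) (simp add: fin del: One_nat_def)
    then show ?thesis using mX[OF that] by (subst (asm) integrable_distr_eq) auto
  qed
  define a where "a = measure_pmf.expectation (pmf_of_set {1..k}) real"
  define q where "q = measure_pmf.expectation (pmf_of_set {1..k}) (\<lambda>n. (real n)\<^sup>2)"
  have ea: "expectation (\<lambda>\<omega>. real (X i \<omega>)) = a" if "1 \<le> i" for i
    using mX[OF that] unfolding a_def DX[OF that, symmetric] by (subst integral_distr) auto
  have eq2: "expectation (\<lambda>\<omega>. (real (X i \<omega>))\<^sup>2) = q" if "1 \<le> i" for i
    using mX[OF that] unfolding q_def DX[OF that, symmetric] by (subst integral_distr) auto
  have indX: "indep_vars (\<lambda>_. borel) (\<lambda>i \<omega>. real (X i \<omega>)) {1..}"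
    by (rule indep_vars_compose2[OF X]) auto
  have W: "linear_moments a (q - a\<^sup>2) UNIV real (\<lambda>n \<omega>. \<Sum>i = 1..n. real (X i \<omega>))"
    by (rule iid_walk_moments[OF indX sq ea eq2])
  have i1: "integrable M (\<lambda>\<omega>. real (X 1 \<omega>))"
    by (rule integrable_of_square) (use mX[of 1] sq[of 1] in auto)
  have "variance (\<lambda>\<omega>. real (X 1 \<omega>)) = q - a\<^sup>2"
    using variance_eq[OF i1 sq[of 1]] ea[of 1] eq2[of 1] by simp
  then have q: "0 \<le> q - a\<^sup>2" by (metis variance_positive)
  have "1 = measure_pmf.expectation (pmf_of_set {1..k}) (\<lambda>_. 1::real)" by simp
  also have "\<dots> \<le> a" unfolding a_def
  proof (rule integral_mono_AE)
    show "AE n in pmf_of_set {1..k}. (1::real) \<le> real n"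
      unfolding AE_measure_pmf_iff fin by simp
  qed (rule integrable_measure_pmf_finite, simp add: fin del: One_nat_def)+
  finally have a: "0 < a" by simp
  let ?F = "vimage_algebra (space M) (\<lambda>\<omega>. \<lambda>i\<in>{1..}. X i \<omega>) (\<Pi>\<^sub>M i\<in>{1..}. count_space UNIV)"
  let ?G = "vimage_algebra (space M) (\<lambda>\<omega>. \<lambda>i\<in>{0..}. N i \<omega>) (\<Pi>\<^sub>M i\<in>{0..}. count_space UNIV)"
  \<comment> \<open>In the composition the walk generates \<open>F\<close> and the clock generates
    \<open>G\<close>, the reverse of the order in \<open>ppok\<close>.\<close>
  have indFG: "indep_set (sets ?F) (sets ?G)"
    using ind indep_set_commute by (simp add: indep_families_def family_sigma_def)
  have mF: "X i \<in> measurable ?F (count_space UNIV)" if "1 \<le> i" for i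
    by (rule measurable_family_vimage) (use mX that in auto)
  have mG: "N t \<in> measurable ?G (count_space UNIV)" if "0 \<le> t" for t
    by (rule measurable_family_vimage) (use poisson_process_measurable[OF N] that in auto)
  have "linear_moments (a * b) ((q - a\<^sup>2) * b + a\<^sup>2 * w) {0..} (\<lambda>t. t) (\<lambda>t \<omega>. \<Sum>i = 1..N t \<omega>. real (X i \<omega>))"
  proof (rule linear_moments_compose[OF indFG _ _ _ _ W LN])
    show "(\<lambda>\<omega>. \<Sum>i = 1..n. real (X i \<omega>)) \<in> borel_measurable ?F" for n
      by (intro borel_measurable_sum measurable_compose[OF mF]) auto
  qed (use mG mono in auto)
  moreover have "linear_moments a' w' {0..} (\<lambda>t. t) (\<lambda>t \<omega>. real (Nk t \<omega>))"
    if "linear_moments a' w' {0..} (\<lambda>t. t) (\<lambda>t \<omega>. \<Sum>i = 1..N t \<omega>. real (X i \<omega>))" for a' w'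
    using that unfolding linear_moments_def
    by (simp add: eq cong: measurable_cong Bochner_Integration.integral_cong Bochner_Integration.integrable_cong)
  ultimately have "linear_moments (a * b) ((q - a\<^sup>2) * b + a\<^sup>2 * w) {0..} (\<lambda>t. t) (\<lambda>t \<omega>. real (Nk t \<omega>))"
    by blast
  moreover have "AE \<omega> in M. Nk s \<omega> \<le> Nk t \<omega>" if "0 \<le> s" "s \<le> t" for s t
    using mono[OF that] AE_space
    by eventually_elim (use that in \<open>auto simp: eq intro!: sum_mono2\<close>)
  moreover have "0 < a * b" "0 < (q - a\<^sup>2) * b + a\<^sup>2 * w"
    using a bw q by (auto intro!: add_nonneg_pos)
  ultimately show ?thesis using that by blast
qed

end

section \<open>Compound Poisson processes of order k and their jump law\<close>

text \<open>A distribution is determined by its distribution function. This turns conditions on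
  \<open>interval_measure H\<close> into conditions on the law of each jump.\<close>

lemma (in real_distribution) interval_measure_cdf: "interval_measure (cdf M) = M"
proof (rule cdf_unique)
  show "real_distribution (interval_measure (cdf M))"
    by (rule real_distribution_interval_measure)
      (auto intro: cdf_nondecreasing cdf_is_right_cont cdf_lim_at_bot cdf_lim_at_top_prob)
  show "real_distribution M" by unfold_locales
  show "cdf (interval_measure (cdf M)) = cdf M"
    by (rule cdf_interval_measure)
      (auto intro: cdf_nondecreasing cdf_is_right_cont cdf_lim_at_bot)
qed

context prob_space
begin

lemma linear_moments_cong:
  assumes "linear_moments a v T \<tau> U" and "\<And>i \<omega>. i \<in> T \<Longrightarrow> \<omega> \<in> space M \<Longrightarrow> U i \<omega> = V i \<omega>"
  shows "linear_moments a v T \<tau> V"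
proof -
  have "expectation (V i) = expectation (U i)" if "i \<in> T" for i
    by (rule Bochner_Integration.integral_cong) (use assms(2) that in auto)
  moreover have "expectation (\<lambda>\<omega>. V i \<omega> * V j \<omega>) = expectation (\<lambda>\<omega>. U i \<omega> * U j \<omega>)" if "i \<in> T" "j \<in> T" for i j
    by (rule Bochner_Integration.integral_cong) (use assms(2) that in auto)
  moreover have "integrable M (\<lambda>\<omega>. (V i \<omega>)\<^sup>2) \<longleftrightarrow> integrable M (\<lambda>\<omega>. (U i \<omega>)\<^sup>2)" if "i \<in> T" for i
    by (rule Bochner_Integration.integrable_cong) (use assms(2) that in auto)
  moreover have "V i \<in> borel_measurable M \<longleftrightarrow> U i \<in> borel_measurable M" if "i \<in> T" for i
    by (rule measurable_cong) (use assms(2) that in auto)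
  ultimately show ?thesis using assms(1) unfolding linear_moments_def by simp
qed

text \<open>The new variance rate is \<open>(q - a\<^sup>2) * b + a\<^sup>2 * w\<close>. If the
  jumps have mean zero it equals \<open>q * b\<close>; otherwise \<open>a\<^sup>2 * w\<close> is
  positive, even for deterministic jumps. So it remains to see that q is positive, and this is where
  \<open>H0\<close> enters.\<close>

lemma cppok_moments:
  assumes P: "cppok k r H Z" and k: "1 \<le> k" and r: "0 < r"
    and H2: "integrable (interval_measure H) (\<lambda>y. y\<^sup>2)"
    and H0: "H \<noteq> indicat_real {0..}"
  obtains a v where "0 < v" "linear_moments a v {0..} (\<lambda>t. t) Z"
proof -
  obtain Nk Y where Nk: "ppok k r Nk"
    and Y: "indep_vars (\<lambda>_. borel) Y {1..}"
    and cdf: "\<And>i. i \<ge> 1 \<Longrightarrow> cdf (distr M borel (Y i)) = H"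
    and ind: "indep_families {0..} (count_space UNIV) Nk {1..} borel Y"
    and eq: "\<And>t \<omega>. t \<ge> 0 \<Longrightarrow> \<omega> \<in> space M \<Longrightarrow> Z t \<omega> = (\<Sum>i = 1..Nk t \<omega>. Y i \<omega>)"
    using P unfolding cppok_def by blast
  obtain b w where bw: "0 < b" "0 < w"
    and LN: "linear_moments b w {0..} (\<lambda>t. t) (\<lambda>t \<omega>. real (Nk t \<omega>))"
    and mono: "\<And>s t. 0 \<le> s \<Longrightarrow> s \<le> t \<Longrightarrow> AE \<omega> in M. Nk s \<omega> \<le> Nk t \<omega>"
    using ppok_moments[OF Nk k r] by blast
  have mY: "Y i \<in> borel_measurable M" if "1 \<le> i" for i
    using Y that by (auto simp: indep_vars_def)
  have mN: "Nk t \<in> measurable M (count_space UNIV)" if "0 \<le> t" for t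
    using ind that by (auto simp: indep_families_def)
  have D: "distr M borel (Y i) = interval_measure H" if "1 \<le> i" for i
  proof -
    interpret D: real_distribution "distr M borel (Y i)"
      using mY[OF that] by simp
    show ?thesis using D.interval_measure_cdf cdf[OF that] by simp
  qed
  have sq: "integrable M (\<lambda>\<omega>. (Y i \<omega>)\<^sup>2)" if "1 \<le> i" for i
    using H2 mY[OF that] unfolding D[OF that, symmetric] by (subst (asm) integrable_distr_eq) auto
  define a where "a = (\<integral>y. y \<partial>interval_measure H)"
  define q where "q = (\<integral>y. y\<^sup>2 \<partial>interval_measure H)"
  have ea: "expectation (Y i) = a" if "1 \<le> i" for i
    using mY[OF that] unfolding a_def D[OF that, symmetric] by (subst integral_distr) auto
  have eq2: "expectation (\<lambda>\<omega>. (Y i \<omega>)\<^sup>2) = q" if "1 \<le> i" for i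
    using mY[OF that] unfolding q_def D[OF that, symmetric] by (subst integral_distr) auto
  note W = iid_walk_moments[OF Y sq ea eq2]
  have "integrable M (Y 1)" using integrable_of_square[OF mY[of 1] sq[of 1]] by simp
  then have "variance (Y 1) = q - a\<^sup>2"
    using variance_eq[of "Y 1"] sq[of 1] ea[of 1] eq2[of 1] by simp
  then have var: "0 \<le> q - a\<^sup>2" by (metis variance_positive)
  \<comment> \<open>A vanishing second moment would make the jump almost surely 0, and then H would
    be the distribution function of the unit mass at 0.\<close>
  have "q \<noteq> 0"
  proof
    assume "q = 0"
    then have "AE \<omega> in M. (Y 1 \<omega>)\<^sup>2 = 0"
      using eq2[of 1] integral_nonneg_eq_0_iff_AE[OF sq[of 1]] by simp
    then have Y0: "AE \<omega> in M. Y 1 \<omega> = 0" by simp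
    note [measurable] = mY[of 1, simplified]
    have "H x = indicat_real {0..} x" for x
    proof -
      have "H x = prob {\<omega>\<in>space M. Y 1 \<omega> \<le> x}"
        unfolding cdf[of 1, simplified, symmetric] cdf_def
        by (subst measure_distr) (auto intro!: arg_cong[where f=prob])
      also have "\<dots> = indicat_real {0..} x"
      proof (cases "0 \<le> x")
        case True
        have "AE \<omega> in M. Y 1 \<omega> \<le> x" using Y0 by eventually_elim (use True in simp)
        then have "prob {\<omega>\<in>space M. Y 1 \<omega> \<le> x} = 1" by (intro prob_eq_1[THEN iffD2]) auto
        then show ?thesis using True by simp
      next
        case False
        have "AE \<omega> in M. \<not> Y 1 \<omega> \<le> x" using Y0 by eventually_elim (use False in simp)
        then have "prob {\<omega>\<in>space M. Y 1 \<omega> \<le> x} = 0" by (intro prob_eq_0[THEN iffD2]) auto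
        then show ?thesis using False by simp
      qed
      finally show ?thesis .
    qed
    then show False using H0 by auto
  qed
  moreover have "0 \<le> a\<^sup>2" by simp
  ultimately have q: "0 < q" using var by linarith
  let ?F = "vimage_algebra (space M) (\<lambda>\<omega>. \<lambda>i\<in>{1..}. Y i \<omega>) (\<Pi>\<^sub>M i\<in>{1..}. borel)"
  let ?G = "vimage_algebra (space M) (\<lambda>\<omega>. \<lambda>i\<in>{0..}. Nk i \<omega>) (\<Pi>\<^sub>M i\<in>{0..}. count_space UNIV)"
  have indFG: "indep_set (sets ?F) (sets ?G)"
    using ind indep_set_commute by (simp add: indep_families_def family_sigma_def)
  have mF: "Y i \<in> measurable ?F borel" if "1 \<le> i" for i
    by (rule measurable_family_vimage) (use mY that in auto)
  have mG: "Nk t \<in> measurable ?G (count_space UNIV)" if "0 \<le> t" for t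
    by (rule measurable_family_vimage) (use mN that in auto)
  have "linear_moments (a * b) ((q - a\<^sup>2) * b + a\<^sup>2 * w) {0..} (\<lambda>t. t) (\<lambda>t \<omega>. \<Sum>i = 1..Nk t \<omega>. Y i \<omega>)"
  proof (rule linear_moments_compose[OF indFG _ _ _ _ W LN])
    show "(\<lambda>\<omega>. \<Sum>i = 1..n. Y i \<omega>) \<in> borel_measurable ?F" for n
      by (intro borel_measurable_sum mF) auto
  qed (use mG mono in auto)
  then have "linear_moments (a * b) ((q - a\<^sup>2) * b + a\<^sup>2 * w) {0..} (\<lambda>t. t) Z"
    by (rule linear_moments_cong) (simp add: eq)
  moreover have "0 < (q - a\<^sup>2) * b + a\<^sup>2 * w"
    using q bw var by (cases "a = 0") (auto intro!: add_nonneg_pos)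
  ultimately show ?thesis using that by blast
qed

text \<open>\<open>Z\<close> depends on time only through the integer-valued \<open>N\<close>, whose
  right-continuous paths must be constant just after each time. All times share one null set, which
  is essential for evaluating \<open>Z\<close> at a random time.\<close>

lemma cppok_right_constant:
  assumes P: "cppok k r H Z"
  shows "AE \<omega> in M. \<forall>t\<ge>0. eventually (\<lambda>s. Z s \<omega> = Z t \<omega>) (at_right t)"
proof -
  obtain Nk Y where Nk: "ppok k r Nk"
    and eqZ: "\<And>t \<omega>. t \<ge> 0 \<Longrightarrow> \<omega> \<in> space M \<Longrightarrow> Z t \<omega> = (\<Sum>i = 1..Nk t \<omega>. Y i \<omega>)"
    using P unfolding cppok_def by blast
  obtain N X where N: "poisson_process (real k * r) N"
    and eqN: "\<And>t \<omega>. t \<ge> 0 \<Longrightarrow> \<omega> \<in> space M \<Longrightarrow> Nk t \<omega> = (\<Sum>i = 1..N t \<omega>. X i \<omega>)"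
    using Nk unfolding ppok_def by blast
  have "AE \<omega> in M. cadlag_path (\<lambda>t. real (N t \<omega>))"
    using N by (auto simp: poisson_process_def levy_process_def)
  then show ?thesis using AE_space
  proof eventually_elim
    case (elim \<omega>)
    show ?case
    proof (intro allI impI)
      fix t :: real assume t: "0 \<le> t"
      have "((\<lambda>t. real (N t \<omega>)) \<longlongrightarrow> real (N t \<omega>)) (at_right t)"
        using elim(1) t by (auto simp: cadlag_path_def continuous_within)
      then have "eventually (\<lambda>s. dist (real (N s \<omega>)) (real (N t \<omega>)) < 1) (at_right t)"
        by (rule tendstoD) simp
      moreover have "eventually (\<lambda>s. t < s) (at_right t)"
        by (simp add: eventually_at_right_less)
      ultimately show "eventually (\<lambda>s. Z s \<omega> = Z t \<omega>) (at_right t)"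
      proof eventually_elim
        case (elim s)
        \<comment> \<open>Two natural numbers at distance less than 1 coincide.\<close>
        then have "N s \<omega> = N t \<omega>" by (simp add: dist_real_def abs_less_iff)
        then show ?case using elim(2) t \<open>\<omega> \<in> space M\<close> by (simp add: eqZ eqN)
      qed
    qed
  qed
qed

section \<open>Convergence in mean square\<close>

lemma expectation_Cauchy_Schwarz:
  fixes X Y :: "'a \<Rightarrow> real"
  assumes [measurable]: "X \<in> borel_measurable M" "Y \<in> borel_measurable M"
    and X2: "integrable M (\<lambda>\<omega>. (X \<omega>)\<^sup>2)" and Y2: "integrable M (\<lambda>\<omega>. (Y \<omega>)\<^sup>2)"
  shows "\<bar>expectation (\<lambda>\<omega>. X \<omega> * Y \<omega>)\<bar> \<le> sqrt (expectation (\<lambda>\<omega>. (X \<omega>)\<^sup>2) * expectation (\<lambda>\<omega>. (Y \<omega>)\<^sup>2))"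
proof -
  have XY: "integrable M (\<lambda>\<omega>. X \<omega> * Y \<omega>)"
    by (rule integrable_prod_of_squares) (use X2 Y2 in auto)
  let ?e = "expectation (\<lambda>\<omega>. \<bar>X \<omega> * Y \<omega>\<bar>)"
  have "(\<integral>\<^sup>+\<omega>. ennreal \<bar>X \<omega>\<bar> * ennreal \<bar>Y \<omega>\<bar> \<partial>M) = ennreal ?e"
    using nn_integral_eq_integral[OF integrable_abs[OF XY]] by (simp add: abs_mult ennreal_mult)
  moreover have "(\<integral>\<^sup>+\<omega>. (ennreal \<bar>X \<omega>\<bar>)\<^sup>2 \<partial>M) = ennreal (expectation (\<lambda>\<omega>. (X \<omega>)\<^sup>2))"
    using X2 by (simp add: nn_integral_eq_integral ennreal_power)
  moreover have "(\<integral>\<^sup>+\<omega>. (ennreal \<bar>Y \<omega>\<bar>)\<^sup>2 \<partial>M) = ennreal (expectation (\<lambda>\<omega>. (Y \<omega>)\<^sup>2))"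
    using Y2 by (simp add: nn_integral_eq_integral ennreal_power)
  ultimately have "(ennreal ?e)\<^sup>2 \<le> ennreal (expectation (\<lambda>\<omega>. (X \<omega>)\<^sup>2)) * ennreal (expectation (\<lambda>\<omega>. (Y \<omega>)\<^sup>2))"
    using Cauchy_Schwarz_nn_integral[of "\<lambda>\<omega>. ennreal \<bar>X \<omega>\<bar>" M "\<lambda>\<omega>. ennreal \<bar>Y \<omega>\<bar>"] by simp
  then have "?e\<^sup>2 \<le> expectation (\<lambda>\<omega>. (X \<omega>)\<^sup>2) * expectation (\<lambda>\<omega>. (Y \<omega>)\<^sup>2)"
    by (simp add: ennreal_power flip: ennreal_mult)
  then have "?e \<le> sqrt (expectation (\<lambda>\<omega>. (X \<omega>)\<^sup>2) * expectation (\<lambda>\<omega>. (Y \<omega>)\<^sup>2))"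
    by (rule real_le_rsqrt)
  then show ?thesis using integral_abs_bound[of M "\<lambda>\<omega>. X \<omega> * Y \<omega>"] by linarith
qed

lemma integrable_square_diff:
  fixes X Y :: "'a \<Rightarrow> real"
  assumes "X \<in> borel_measurable M" "Y \<in> borel_measurable M"
    and "integrable M (\<lambda>\<omega>. (X \<omega>)\<^sup>2)" "integrable M (\<lambda>\<omega>. (Y \<omega>)\<^sup>2)"
  shows "integrable M (\<lambda>\<omega>. (X \<omega> - Y \<omega>)\<^sup>2)"
  using assms integrable_prod_of_squares[OF assms] by (simp add: power2_diff mult.assoc)

text \<open>The error of the product splits into the product of both errors and two terms with one
  error each. Cauchy-Schwarz bounds each of the three by a square root that tends to 0.\<close>

lemma L2_tendsto_expectation_mult:
  fixes V W :: "nat \<Rightarrow> 'a \<Rightarrow> real" and V' W' :: "'a \<Rightarrow> real"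
  assumes V: "\<And>n. V n \<in> borel_measurable M" "\<And>n. integrable M (\<lambda>\<omega>. (V n \<omega>)\<^sup>2)"
    and W: "\<And>n. W n \<in> borel_measurable M" "\<And>n. integrable M (\<lambda>\<omega>. (W n \<omega>)\<^sup>2)"
    and V': "V' \<in> borel_measurable M" "integrable M (\<lambda>\<omega>. (V' \<omega>)\<^sup>2)"
    and W': "W' \<in> borel_measurable M" "integrable M (\<lambda>\<omega>. (W' \<omega>)\<^sup>2)"
    and limV: "(\<lambda>n. expectation (\<lambda>\<omega>. (V n \<omega> - V' \<omega>)\<^sup>2)) \<longlonglongrightarrow> 0"
    and limW: "(\<lambda>n. expectation (\<lambda>\<omega>. (W n \<omega> - W' \<omega>)\<^sup>2)) \<longlonglongrightarrow> 0"
  shows "(\<lambda>n. expectation (\<lambda>\<omega>. V n \<omega> * W n \<omega>)) \<longlonglongrightarrow> expectation (\<lambda>\<omega>. V' \<omega> * W' \<omega>)"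
proof -
  let ?dV = "\<lambda>n \<omega>. V n \<omega> - V' \<omega>" and ?dW = "\<lambda>n \<omega>. W n \<omega> - W' \<omega>"
  let ?eV = "\<lambda>n. expectation (\<lambda>\<omega>. (?dV n \<omega>)\<^sup>2)" and ?eW = "\<lambda>n. expectation (\<lambda>\<omega>. (?dW n \<omega>)\<^sup>2)"
  have dV: "?dV n \<in> borel_measurable M" "integrable M (\<lambda>\<omega>. (?dV n \<omega>)\<^sup>2)" for n
    using integrable_square_diff[OF V(1) V'(1) V(2) V'(2)] V V' by auto
  have dW: "?dW n \<in> borel_measurable M" "integrable M (\<lambda>\<omega>. (?dW n \<omega>)\<^sup>2)" for n
    using integrable_square_diff[OF W(1) W'(1) W(2) W'(2)] W W' by auto
  let ?B = "\<lambda>n. sqrt (?eV n * ?eW n) + sqrt (expectation (\<lambda>\<omega>. (V' \<omega>)\<^sup>2) * ?eW n) + sqrt (?eV n * expectation (\<lambda>\<omega>. (W' \<omega>)\<^sup>2))"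
  have bound: "\<bar>expectation (\<lambda>\<omega>. V n \<omega> * W n \<omega>) - expectation (\<lambda>\<omega>. V' \<omega> * W' \<omega>)\<bar> \<le> ?B n" for n
  proof -
    have i: "integrable M (\<lambda>\<omega>. ?dV n \<omega> * ?dW n \<omega>)" "integrable M (\<lambda>\<omega>. V' \<omega> * ?dW n \<omega>)"
      "integrable M (\<lambda>\<omega>. ?dV n \<omega> * W' \<omega>)" "integrable M (\<lambda>\<omega>. V' \<omega> * W' \<omega>)"
      by (rule integrable_prod_of_squares, fact+)+
    have "expectation (\<lambda>\<omega>. V n \<omega> * W n \<omega>) =
      expectation (\<lambda>\<omega>. ?dV n \<omega> * ?dW n \<omega> + V' \<omega> * ?dW n \<omega> + ?dV n \<omega> * W' \<omega> + V' \<omega> * W' \<omega>)"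
      by (rule Bochner_Integration.integral_cong) (simp_all add: algebra_simps)
    also have "\<dots> = expectation (\<lambda>\<omega>. ?dV n \<omega> * ?dW n \<omega>) + expectation (\<lambda>\<omega>. V' \<omega> * ?dW n \<omega>)
      + expectation (\<lambda>\<omega>. ?dV n \<omega> * W' \<omega>) + expectation (\<lambda>\<omega>. V' \<omega> * W' \<omega>)"
      using i by (simp only: Bochner_Integration.integral_add Bochner_Integration.integrable_add)
    finally show ?thesis
      using expectation_Cauchy_Schwarz[OF dV(1) dW(1) dV(2) dW(2), of n n]
        expectation_Cauchy_Schwarz[OF V'(1) dW(1) V'(2) dW(2), of n]
        expectation_Cauchy_Schwarz[OF dV(1) W'(1) dV(2) W'(2), of n]
      by linarith
  qed
  have "?B \<longlonglongrightarrow> sqrt (0 * 0) + sqrt (expectation (\<lambda>\<omega>. (V' \<omega>)\<^sup>2) * 0) + sqrt (0 * expectation (\<lambda>\<omega>. (W' \<omega>)\<^sup>2))"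
    by (intro tendsto_intros limV limW)
  then have "?B \<longlonglongrightarrow> 0" by simp
  then have "(\<lambda>n. expectation (\<lambda>\<omega>. V n \<omega> * W n \<omega>) - expectation (\<lambda>\<omega>. V' \<omega> * W' \<omega>)) \<longlonglongrightarrow> 0"
    by (rule Lim_null_comparison[rotated]) (use bound in simp)
  then show ?thesis by (simp add: LIM_zero_iff)
qed

text \<open>Fatou's lemma along the almost sure limit. With \<open>X\<close> a member of the
  sequence, a Cauchy estimate uniform in later members becomes a bound on the distance to the limit,
  and square integrability of that distance is a conclusion.\<close>

lemma L2_bound_AE_limit:
  fixes V :: "nat \<Rightarrow> 'a \<Rightarrow> real"
  assumes V: "\<And>n. V n \<in> borel_measurable M" "\<And>n. integrable M (\<lambda>\<omega>. (V n \<omega>)\<^sup>2)"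
    and X: "X \<in> borel_measurable M" "integrable M (\<lambda>\<omega>. (X \<omega>)\<^sup>2)" and V': "V' \<in> borel_measurable M"
    and lim: "AE \<omega> in M. (\<lambda>m. V m \<omega>) \<longlonglongrightarrow> V' \<omega>"
    and le: "\<And>m. k \<le> m \<Longrightarrow> expectation (\<lambda>\<omega>. (X \<omega> - V m \<omega>)\<^sup>2) \<le> B"
  shows "integrable M (\<lambda>\<omega>. (X \<omega> - V' \<omega>)\<^sup>2)" "expectation (\<lambda>\<omega>. (X \<omega> - V' \<omega>)\<^sup>2) \<le> B"
proof -
  note [measurable] = V(1) X(1) V'
  have i: "integrable M (\<lambda>\<omega>. (X \<omega> - V m \<omega>)\<^sup>2)" for m
    by (rule integrable_square_diff) (use V X in auto)
  have "0 \<le> expectation (\<lambda>\<omega>. (X \<omega> - V k \<omega>)\<^sup>2)" by simp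
  then have B: "0 \<le> B" using le[of k] by linarith
  have "(\<integral>\<^sup>+\<omega>. ennreal ((X \<omega> - V' \<omega>)\<^sup>2) \<partial>M) = (\<integral>\<^sup>+\<omega>. liminf (\<lambda>m. ennreal ((X \<omega> - V m \<omega>)\<^sup>2)) \<partial>M)"
  proof (rule nn_integral_cong_AE)
    show "AE \<omega> in M. ennreal ((X \<omega> - V' \<omega>)\<^sup>2) = liminf (\<lambda>m. ennreal ((X \<omega> - V m \<omega>)\<^sup>2))"
      using lim
    proof eventually_elim
      case (elim \<omega>)
      then have "(\<lambda>m. ennreal ((X \<omega> - V m \<omega>)\<^sup>2)) \<longlonglongrightarrow> ennreal ((X \<omega> - V' \<omega>)\<^sup>2)"
        by (intro tendsto_ennrealI tendsto_intros)
      then show ?case by (intro lim_imp_Liminf[symmetric]) auto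
    qed
  qed
  also have "\<dots> \<le> liminf (\<lambda>m. \<integral>\<^sup>+\<omega>. ennreal ((X \<omega> - V m \<omega>)\<^sup>2) \<partial>M)"
    by (rule nn_integral_liminf) simp
  also have "\<dots> \<le> liminf (\<lambda>m. ennreal B)"
  proof (rule Liminf_mono)
    show "eventually (\<lambda>m. (\<integral>\<^sup>+\<omega>. ennreal ((X \<omega> - V m \<omega>)\<^sup>2) \<partial>M) \<le> ennreal B) sequentially"
      using eventually_ge_at_top[of k]
    proof eventually_elim
      case (elim m)
      then show ?case using le[OF elim] by (simp add: nn_integral_eq_integral[OF i] ennreal_leI)
    qed
  qed
  also have "\<dots> = ennreal B" by (simp add: Liminf_const)
  finally have *: "(\<integral>\<^sup>+\<omega>. ennreal ((X \<omega> - V' \<omega>)\<^sup>2) \<partial>M) \<le> ennreal B" .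
  show int: "integrable M (\<lambda>\<omega>. (X \<omega> - V' \<omega>)\<^sup>2)"
    by (rule integrableI_bounded) (use * in \<open>auto simp: less_top[symmetric] top_unique\<close>)
  show "expectation (\<lambda>\<omega>. (X \<omega> - V' \<omega>)\<^sup>2) \<le> B"
    using * B by (simp add: nn_integral_eq_integral[OF int])
qed

end

section \<open>Dyadic discretisation of time\<close>

text \<open>
  The approximation lies strictly above its (nonnegative) argument, so right continuity of the paths of \<open>Z\<close>
  suffices for the passage to the limit.
\<close>

definition dyadic_above :: "nat \<Rightarrow> real \<Rightarrow> real" where
  "dyadic_above n x = real (Suc (nat \<lfloor>2 ^ n * x\<rfloor>)) / 2 ^ n"

text \<open>No sign condition on x is needed here because \<open>nat\<close> sends negative floors
  to 0, giving the value \<open>1 / 2 ^ n\<close>. The approximate clock thus stays among the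
  admissible times even on the null set where the clock is negative.\<close>

lemma dyadic_above_pos: "0 < dyadic_above n x"
  by (simp add: dyadic_above_def)

lemma dyadic_above_bounds:
  assumes "0 \<le> x"
  shows "x < dyadic_above n x" "dyadic_above n x \<le> x + 1 / 2 ^ n"
proof -
  have 0: "0 \<le> 2 ^ n * x" using assms by simp
  have "real (nat \<lfloor>2 ^ n * x\<rfloor>) = of_int \<lfloor>2 ^ n * x\<rfloor>" using 0 by simp
  then have "2 ^ n * x < real (Suc (nat \<lfloor>2 ^ n * x\<rfloor>))" "real (Suc (nat \<lfloor>2 ^ n * x\<rfloor>)) \<le> 2 ^ n * x + 1"
    by linarith+
  then show "x < dyadic_above n x" "dyadic_above n x \<le> x + 1 / 2 ^ n"
    by (simp_all add: dyadic_above_def field_simps)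
qed

lemma dyadic_above_le_Suc: "0 \<le> x \<Longrightarrow> dyadic_above n x \<le> x + 1"
  using dyadic_above_bounds(2)[of x n] by (rule order_trans) (auto simp: field_simps)

lemma dyadic_above_diff:
  assumes "0 \<le> x" "n \<le> m"
  shows "\<bar>dyadic_above n x - dyadic_above m x\<bar> \<le> 1 / 2 ^ n"
proof -
  have "(1::real) / 2 ^ m \<le> 1 / 2 ^ n"
    using assms(2) by (intro divide_left_mono power_increasing) auto
  then show ?thesis
    using dyadic_above_bounds[OF assms(1), of n] dyadic_above_bounds[OF assms(1), of m] by linarith
qed

lemma dyadic_above_at_right:
  assumes "0 \<le> x"
  shows "filterlim (\<lambda>n. dyadic_above n x) (at_right x) sequentially"
proof -
  have "(\<lambda>n. 1 / 2 ^ n :: real) \<longlonglongrightarrow> 0"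
    using LIMSEQ_power_zero[of "1 / 2 :: real"] unfolding power_one_over by simp
  then have "(\<lambda>n. x + 1 / 2 ^ n) \<longlonglongrightarrow> x + 0"
    by (intro tendsto_add tendsto_const)
  then have "(\<lambda>n. x + 1 / 2 ^ n) \<longlonglongrightarrow> x" by simp
  then have "(\<lambda>n. dyadic_above n x) \<longlonglongrightarrow> x"
    by (rule tendsto_sandwich[rotated 2, OF tendsto_const])
      (intro always_eventually allI less_imp_le dyadic_above_bounds[OF assms])+
  moreover have "dyadic_above n x \<noteq> x" for n
    using dyadic_above_bounds(1)[OF assms, of n] by simp
  ultimately show ?thesis
    using dyadic_above_bounds(1)[OF assms] by (auto simp: filterlim_at)
qed

context prob_space
begin

section \<open>Time change by an independent nondecreasing process\<close>

lemma integrable_linear_bound_square: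
  fixes A B :: "'a \<Rightarrow> real"
  assumes [measurable]: "A \<in> borel_measurable M" "B \<in> borel_measurable M"
    and B: "integrable M (\<lambda>\<omega>. (B \<omega>)\<^sup>2)" and le: "AE \<omega> in M. \<bar>A \<omega>\<bar> \<le> \<bar>B \<omega>\<bar> + c" and c: "0 \<le> c"
  shows "integrable M (\<lambda>\<omega>. (A \<omega>)\<^sup>2)"
proof (rule Bochner_Integration.integrable_bound)
  show "integrable M (\<lambda>\<omega>. 2 * (B \<omega>)\<^sup>2 + 2 * c\<^sup>2)" using B by simp
  show "AE \<omega> in M. norm ((A \<omega>)\<^sup>2) \<le> norm (2 * (B \<omega>)\<^sup>2 + 2 * c\<^sup>2)"
    using le
  proof eventually_elim
    case (elim \<omega>)
    have "(A \<omega>)\<^sup>2 \<le> (\<bar>B \<omega>\<bar> + c)\<^sup>2" using elim by (metis abs_ge_zero power2_abs power_mono)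
    also have "\<dots> \<le> 2 * (B \<omega>)\<^sup>2 + 2 * c\<^sup>2"
      using zero_le_power2[of "\<bar>B \<omega>\<bar> - c"] by (simp add: power2_sum power2_diff)
    finally show ?case by simp
  qed
qed simp

text \<open>On the grid of mesh \<open>1 / 2 ^ m\<close> the process is a sequence indexed by
  numerators, with linear moments for the rates \<open>a / 2 ^ m\<close> and
  \<open>v / 2 ^ m\<close>. Integer-clock moments apply to it, and the powers of 2 recombine with
  the numerators \<open>K\<close> and \<open>K'\<close>.\<close>

lemma linear_moments_dyadic_time_change:
  assumes lin: "linear_moments a v {0..} (\<lambda>t. t) Z"
    and ind: "indep_set (sets F) (sets G)" and sp: "space F = space M" "space G = space M"
    and Z: "\<And>t. 0 \<le> t \<Longrightarrow> Z t \<in> borel_measurable F"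
    and K: "K \<in> measurable G (count_space UNIV)" "K' \<in> measurable G (count_space UNIV)"
    and K2: "integrable M (\<lambda>\<omega>. (real (K \<omega>) / 2 ^ m)\<^sup>2)" "integrable M (\<lambda>\<omega>. (real (K' \<omega>) / 2 ^ m)\<^sup>2)"
  shows "(\<lambda>\<omega>. Z (real (K \<omega>) / 2 ^ m) \<omega>) \<in> borel_measurable M"
    and "integrable M (\<lambda>\<omega>. (Z (real (K \<omega>) / 2 ^ m) \<omega>)\<^sup>2)"
    and "expectation (\<lambda>\<omega>. Z (real (K \<omega>) / 2 ^ m) \<omega>) = a * expectation (\<lambda>\<omega>. real (K \<omega>) / 2 ^ m)"
    and "expectation (\<lambda>\<omega>. Z (real (K \<omega>) / 2 ^ m) \<omega> * Z (real (K' \<omega>) / 2 ^ m) \<omega>) =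
      v * expectation (\<lambda>\<omega>. min (real (K \<omega>) / 2 ^ m) (real (K' \<omega>) / 2 ^ m))
      + a\<^sup>2 * expectation (\<lambda>\<omega>. (real (K \<omega>) / 2 ^ m) * (real (K' \<omega>) / 2 ^ m))"
proof -
  let ?U = "\<lambda>j. Z (real j / 2 ^ m)"
  have min: "min (real i / 2 ^ m) (real j / 2 ^ m) = real (min i j) / 2 ^ m" for i j
    by (simp add: min_def divide_le_cancel)
  have l: "linear_moments (a / 2 ^ m) (v / 2 ^ m) UNIV real ?U"
    using lin unfolding linear_moments_def by (simp add: min of_nat_min field_simps power2_eq_square)
  have K2': "integrable M (\<lambda>\<omega>. (real (K \<omega>))\<^sup>2)" "integrable M (\<lambda>\<omega>. (real (K' \<omega>))\<^sup>2)"
    using K2[THEN integrable_mult_right, of "(2 ^ m)\<^sup>2"] by (simp_all add: power_divide)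
  have Z': "?U j \<in> borel_measurable F" for j using Z by simp
  note * = indep_index_moments[where U = ?U, OF ind sp Z' K l K2']
  show "(\<lambda>\<omega>. Z (real (K \<omega>) / 2 ^ m) \<omega>) \<in> borel_measurable M"
    "integrable M (\<lambda>\<omega>. (Z (real (K \<omega>) / 2 ^ m) \<omega>)\<^sup>2)" by (fact *(1,2))+
  show "expectation (\<lambda>\<omega>. Z (real (K \<omega>) / 2 ^ m) \<omega>) = a * expectation (\<lambda>\<omega>. real (K \<omega>) / 2 ^ m)"
    using *(3) by simp
  show "expectation (\<lambda>\<omega>. Z (real (K \<omega>) / 2 ^ m) \<omega> * Z (real (K' \<omega>) / 2 ^ m) \<omega>) =
      v * expectation (\<lambda>\<omega>. min (real (K \<omega>) / 2 ^ m) (real (K' \<omega>) / 2 ^ m))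
      + a\<^sup>2 * expectation (\<lambda>\<omega>. (real (K \<omega>) / 2 ^ m) * (real (K' \<omega>) / 2 ^ m))"
    unfolding min using *(4) by (simp add: power2_eq_square)
qed

text \<open>
  Only the family \<open>Z\<close>, and not the data it is built from, is known to be independent of \<open>S\<close>, so there is
  no monotone dominating process for the approximations. Instead the moment formula itself shows that they
  are Cauchy in mean square.
\<close>

lemma linear_moments_time_change:
  assumes lin: "linear_moments a v {0..} (\<lambda>t. t) Z" and v: "0 \<le> v"
    and ind: "indep_families {0..} borel Z {0..} borel S"
    and linS: "linear_moments b w {0..} (\<lambda>t. t) S"
    and S0: "\<And>t. 0 \<le> t \<Longrightarrow> AE \<omega> in M. 0 \<le> S t \<omega>"
    and monoS: "\<And>s t. 0 \<le> s \<Longrightarrow> s \<le> t \<Longrightarrow> AE \<omega> in M. S s \<omega> \<le> S t \<omega>"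
    and rc: "AE \<omega> in M. \<forall>t\<ge>0. ((\<lambda>s. Z s \<omega>) \<longlongrightarrow> Z t \<omega>) (at_right t)"
    and mX: "\<And>t. 0 \<le> t \<Longrightarrow> X t \<in> borel_measurable M"
    and X: "\<And>t \<omega>. 0 \<le> t \<Longrightarrow> \<omega> \<in> space M \<Longrightarrow> X t \<omega> = Z (S t \<omega>) \<omega>"
  shows "linear_moments (a * b) (v * b + a\<^sup>2 * w) {0..} (\<lambda>t. t) X"
proof -
  let ?F = "vimage_algebra (space M) (\<lambda>\<omega>. \<lambda>t\<in>{0..}. Z t \<omega>) (\<Pi>\<^sub>M t\<in>{0..}. borel)"
  let ?G = "vimage_algebra (space M) (\<lambda>\<omega>. \<lambda>t\<in>{0..}. S t \<omega>) (\<Pi>\<^sub>M t\<in>{0..}. borel)"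
  have indFG: "indep_set (sets ?F) (sets ?G)"
    using ind by (simp add: indep_families_def family_sigma_def)
  have mZ: "Z t \<in> borel_measurable ?F" if "0 \<le> t" for t
    by (rule measurable_family_vimage) (use ind that in \<open>auto simp: indep_families_def\<close>)
  have mSG: "S t \<in> borel_measurable ?G" if "0 \<le> t" for t
    by (rule measurable_family_vimage) (use ind that in \<open>auto simp: indep_families_def\<close>)
  have mS: "S t \<in> borel_measurable M" "integrable M (\<lambda>\<omega>. (S t \<omega>)\<^sup>2)" if "0 \<le> t" for t
    using linS that by (auto simp: linear_moments_def)
  define R where "R n t \<omega> = Suc (nat \<lfloor>2 ^ n * S t \<omega>\<rfloor>)" for n t \<omega>
  define D where "D n t \<omega> = dyadic_above n (S t \<omega>)" for n t \<omega>
  have mR: "(\<lambda>\<omega>. 2 ^ i * R n t \<omega>) \<in> measurable ?G (count_space UNIV)" if "0 \<le> t" for i n t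
  proof -
    note [measurable] = mSG[OF that]
    show ?thesis unfolding R_def by measurable
  qed
  have mD: "D n t \<in> borel_measurable M" if "0 \<le> t" for n t
  proof -
    note [measurable] = mS(1)[OF that]
    show ?thesis unfolding D_def dyadic_above_def by measurable
  qed
  have D2: "integrable M (\<lambda>\<omega>. (D n t \<omega>)\<^sup>2)" if "0 \<le> t" for n t
  proof (rule integrable_linear_bound_square[OF mD[OF that] mS(1)[OF that] mS(2)[OF that], of _ 1])
    show "AE \<omega> in M. \<bar>D n t \<omega>\<bar> \<le> \<bar>S t \<omega>\<bar> + 1" using S0[OF that]
    proof eventually_elim
      case (elim \<omega>)
      then show ?case using dyadic_above_le_Suc[OF elim, of n] dyadic_above_pos[of n "S t \<omega>"] by (simp add: D_def)
    qed
  qed simp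
  \<comment> \<open>The joint moment formula needs both clocks on one grid. A level n is therefore
    rewritten with the finer denominator \<open>2 ^ m\<close>, which explains the factors
    \<open>2 ^ i\<close> in \<open>mR\<close>.\<close>
  have DR: "D n t \<omega> = real (2 ^ (m - n) * R n t \<omega>) / 2 ^ m" if "n \<le> m" for n m t \<omega>
  proof -
    have "(2::real) ^ m = 2 ^ (m - n) * 2 ^ n" using that by (simp flip: power_add)
    moreover have "D n t \<omega> = real (R n t \<omega>) / 2 ^ n"
      by (simp add: D_def dyadic_above_def R_def)
    ultimately show ?thesis by simp
  qed
  define V where "V n t \<omega> = Z (D n t \<omega>) \<omega>" for n t \<omega>
  have K2: "integrable M (\<lambda>\<omega>. (real (2 ^ (m - n) * R n t \<omega>) / 2 ^ m)\<^sup>2)" if "0 \<le> t" "n \<le> m" for n m t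
    using D2[OF that(1), of n] unfolding DR[OF that(2)] .
  have mom: "V n s \<in> borel_measurable M" "integrable M (\<lambda>\<omega>. (V n s \<omega>)\<^sup>2)"
      "expectation (\<lambda>\<omega>. V n s \<omega>) = a * expectation (\<lambda>\<omega>. D n s \<omega>)"
      "expectation (\<lambda>\<omega>. V n s \<omega> * V m t \<omega>) =
        v * expectation (\<lambda>\<omega>. min (D n s \<omega>) (D m t \<omega>)) + a\<^sup>2 * expectation (\<lambda>\<omega>. D n s \<omega> * D m t \<omega>)"
    if s: "0 \<le> s" and t: "0 \<le> t" and nm: "n \<le> m" for n m s t
  proof -
    note * = linear_moments_dyadic_time_change[where K = "\<lambda>\<omega>. 2 ^ (m - n) * R n s \<omega>" and K' = "\<lambda>\<omega>. 2 ^ (m - m) * R m t \<omega>"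
        and m = m, OF lin indFG space_vimage_algebra space_vimage_algebra mZ mR[OF s] mR[OF t] K2[OF s nm] K2[OF t order_refl]]
    show "V n s \<in> borel_measurable M" unfolding V_def DR[OF nm] by (rule *(1))
    show "integrable M (\<lambda>\<omega>. (V n s \<omega>)\<^sup>2)" unfolding V_def DR[OF nm] by (rule *(2))
    show "expectation (\<lambda>\<omega>. V n s \<omega>) = a * expectation (\<lambda>\<omega>. D n s \<omega>)"
      unfolding V_def DR[OF nm] by (rule *(3))
    show "expectation (\<lambda>\<omega>. V n s \<omega> * V m t \<omega>) =
        v * expectation (\<lambda>\<omega>. min (D n s \<omega>) (D m t \<omega>)) + a\<^sup>2 * expectation (\<lambda>\<omega>. D n s \<omega> * D m t \<omega>)"
      unfolding V_def DR[OF nm] DR[OF order_refl, of m] by (rule *(4))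
  qed
  note eVV = mom(4)
  have mV: "V n t \<in> borel_measurable M" and V2: "integrable M (\<lambda>\<omega>. (V n t \<omega>)\<^sup>2)"
    and eV: "expectation (V n t) = a * expectation (D n t)" if "0 \<le> t" for n t
    using mom(1-3)[OF that that order_refl] by auto
  have iD: "integrable M (D n t)" if "0 \<le> t" for n t
    using integrable_of_square[OF mD D2] that by simp
  have iDD: "integrable M (\<lambda>\<omega>. D n s \<omega> * D m t \<omega>)" if "0 \<le> s" "0 \<le> t" for n m s t
    using integrable_prod_of_squares[OF mD mD D2 D2] that by simp
  have imin: "integrable M (\<lambda>\<omega>. min (D n s \<omega>) (D m t \<omega>))" if "0 \<le> s" "0 \<le> t" for n m s t
    using iD that by (intro integrable_min) auto
  have iVV: "integrable M (\<lambda>\<omega>. V n t \<omega> * V m t \<omega>)" if "0 \<le> t" for n m t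
    using integrable_prod_of_squares[OF mV mV V2 V2] that by simp
  let ?C = "\<lambda>n. v * (1 / 2 ^ n) + a\<^sup>2 * (1 / 2 ^ n)\<^sup>2"
  have cauchy: "expectation (\<lambda>\<omega>. (V n t \<omega> - V m t \<omega>)\<^sup>2) \<le> ?C n" if t: "0 \<le> t" and nm: "n \<le> m" for n m t
  proof -
    \<comment> \<open>The Cauchy estimate becomes pointwise: \<open>x + y - 2 * min x y\<close> is
      the distance of the two clock values, and the second bracket is its square. The distance is at
      most \<open>1 / 2 ^ n\<close>, which gives \<open>?C n\<close> because \<open>v\<close> is
      nonnegative.\<close>
    let ?f = "\<lambda>\<omega>. v * (D n t \<omega> + D m t \<omega> - 2 * min (D n t \<omega>) (D m t \<omega>))
      + a\<^sup>2 * (D n t \<omega> * D n t \<omega> + D m t \<omega> * D m t \<omega> - 2 * (D n t \<omega> * D m t \<omega>))"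
    have if': "integrable M ?f"
      using iD iDD imin t by simp
    have "expectation (\<lambda>\<omega>. (V n t \<omega> - V m t \<omega>)\<^sup>2) =
      expectation (\<lambda>\<omega>. V n t \<omega> * V n t \<omega> + V m t \<omega> * V m t \<omega> - 2 * (V n t \<omega> * V m t \<omega>))"
      by (rule Bochner_Integration.integral_cong) (simp_all add: power2_eq_square algebra_simps)
    also have "\<dots> = expectation (\<lambda>\<omega>. V n t \<omega> * V n t \<omega>) + expectation (\<lambda>\<omega>. V m t \<omega> * V m t \<omega>)
      - 2 * expectation (\<lambda>\<omega>. V n t \<omega> * V m t \<omega>)"
      using iVV[OF t] by simp
    also have "\<dots> = v * (expectation (D n t) + expectation (D m t) - 2 * expectation (\<lambda>\<omega>. min (D n t \<omega>) (D m t \<omega>)))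
      + a\<^sup>2 * (expectation (\<lambda>\<omega>. D n t \<omega> * D n t \<omega>) + expectation (\<lambda>\<omega>. D m t \<omega> * D m t \<omega>)
        - 2 * expectation (\<lambda>\<omega>. D n t \<omega> * D m t \<omega>))"
      unfolding eVV[OF t t nm] eVV[OF t t order_refl] by (simp add: algebra_simps)
    also have "\<dots> = expectation ?f"
      using iD[OF t] iDD[OF t t] imin[OF t t] by simp
    also have "\<dots> \<le> ?C n"
    proof (rule integral_le_const[OF if'])
      show "AE \<omega> in M. ?f \<omega> \<le> ?C n"
        using S0[OF t]
      proof eventually_elim
        case (elim \<omega>)
        let ?d = "\<bar>D n t \<omega> - D m t \<omega>\<bar>"
        have d: "?d \<le> 1 / 2 ^ n" using dyadic_above_diff[OF elim nm] by (simp add: D_def)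
        have "?f \<omega> = v * ?d + a\<^sup>2 * ?d\<^sup>2"
          by (simp add: min_def power2_diff power2_eq_square algebra_simps)
        also have "\<dots> \<le> ?C n"
          using d v by (intro add_mono mult_left_mono power_mono) auto
        finally show ?case .
      qed
    qed
    finally show ?thesis .
  qed
  \<comment> \<open>The single null set in \<open>rc\<close> permits evaluation at the random time
    \<open>S t \<omega>\<close>, which the dyadic values approach strictly from the right.\<close>
  have conv: "AE \<omega> in M. (\<lambda>m. V m t \<omega>) \<longlonglongrightarrow> X t \<omega>" if t: "0 \<le> t" for t
    using S0[OF t] rc AE_space
  proof eventually_elim
    case (elim \<omega>)
    then have "((\<lambda>s. Z s \<omega>) \<longlongrightarrow> X t \<omega>) (at_right (S t \<omega>))"
      using X[OF t] by simp
    from filterlim_compose[OF this dyadic_above_at_right[OF elim(1)]]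
    show ?case by (simp add: V_def D_def)
  qed
  have L2: "integrable M (\<lambda>\<omega>. (V n t \<omega> - X t \<omega>)\<^sup>2)" "expectation (\<lambda>\<omega>. (V n t \<omega> - X t \<omega>)\<^sup>2) \<le> ?C n"
    if t: "0 \<le> t" for n t
    using L2_bound_AE_limit[OF mV[OF t] V2[OF t] mV[OF t] V2[OF t] mX[OF t] conv[OF t] cauchy[OF t], of n n] by auto
  \<comment> \<open>Square integrability of \<open>X t\<close> is not assumed; it follows by writing
    \<open>X t\<close> as \<open>V 0 t\<close> minus their square-integrable difference.\<close>
  have X2: "integrable M (\<lambda>\<omega>. (X t \<omega>)\<^sup>2)" if t: "0 \<le> t" for t
    using integrable_square_diff[of "V 0 t" "\<lambda>\<omega>. V 0 t \<omega> - X t \<omega>"] mV[OF t] mX[OF t] V2[OF t] L2(1)[OF t]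
    by simp
  have "(\<lambda>n. 1 / 2 ^ n :: real) \<longlonglongrightarrow> 0"
    using LIMSEQ_power_zero[of "1 / 2 :: real"] unfolding power_one_over by simp
  then have "?C \<longlonglongrightarrow> v * 0 + a\<^sup>2 * 0\<^sup>2"
    by (intro tendsto_intros)
  then have C0: "?C \<longlonglongrightarrow> 0" by simp
  have limV: "(\<lambda>n. expectation (\<lambda>\<omega>. (V n t \<omega> - X t \<omega>)\<^sup>2)) \<longlonglongrightarrow> 0" if t: "0 \<le> t" for t
    by (rule tendsto_sandwich[OF _ _ tendsto_const C0]) (use L2(2)[OF t] in auto)
  have Dlim: "AE \<omega> in M. (\<lambda>n. D n t \<omega>) \<longlonglongrightarrow> S t \<omega>" if t: "0 \<le> t" for t
    using S0[OF t]
  proof eventually_elim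
    case (elim \<omega>)
    then show ?case using dyadic_above_at_right[OF elim] by (auto simp: filterlim_at D_def)
  qed
  have Dle: "AE \<omega> in M. \<forall>n. 0 \<le> D n t \<omega> \<and> D n t \<omega> \<le> S t \<omega> + 1" if t: "0 \<le> t" for t
    using S0[OF t]
    by eventually_elim (auto simp: D_def dyadic_above_le_Suc less_imp_le[OF dyadic_above_pos])
  have iS: "integrable M (S t)" if "0 \<le> t" for t
    using integrable_of_square[OF mS] that by simp
  have iSS: "integrable M (\<lambda>\<omega>. S s \<omega> * S t \<omega>)" if "0 \<le> s" "0 \<le> t" for s t
    using integrable_prod_of_squares[OF mS(1) mS(1) mS(2) mS(2)] that by simp
  have limD: "(\<lambda>n. expectation (D n t)) \<longlonglongrightarrow> expectation (S t)" if t: "0 \<le> t" for t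
  proof (rule integral_dominated_convergence[where w="\<lambda>\<omega>. S t \<omega> + 1"])
    show "AE \<omega> in M. norm (D n t \<omega>) \<le> S t \<omega> + 1" for n
      using Dle[OF t] by eventually_elim auto
  qed (use iS[OF t] Dlim[OF t] mD[OF t] in auto)
  have limmin: "(\<lambda>n. expectation (\<lambda>\<omega>. min (D n s \<omega>) (D n t \<omega>))) \<longlonglongrightarrow> expectation (\<lambda>\<omega>. min (S s \<omega>) (S t \<omega>))"
    if s: "0 \<le> s" and t: "0 \<le> t" for s t
  proof (rule integral_dominated_convergence[where w="\<lambda>\<omega>. S t \<omega> + 1"])
    show "AE \<omega> in M. norm (min (D n s \<omega>) (D n t \<omega>)) \<le> S t \<omega> + 1" for n
      using Dle[OF s] Dle[OF t]
    proof eventually_elim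
      case (elim \<omega>)
      then have "0 \<le> D n s \<omega>" "0 \<le> D n t \<omega>" "D n t \<omega> \<le> S t \<omega> + 1" by blast+
      then show ?case by (simp add: min_def)
    qed
    show "AE \<omega> in M. (\<lambda>n. min (D n s \<omega>) (D n t \<omega>)) \<longlonglongrightarrow> min (S s \<omega>) (S t \<omega>)"
      using Dlim[OF s] Dlim[OF t] by eventually_elim (rule tendsto_min)
  qed (use iS mD mS s t in auto)
  have limDD: "(\<lambda>n. expectation (\<lambda>\<omega>. D n s \<omega> * D n t \<omega>)) \<longlonglongrightarrow> expectation (\<lambda>\<omega>. S s \<omega> * S t \<omega>)"
    if s: "0 \<le> s" and t: "0 \<le> t" for s t
  \<comment> \<open>At every level the approximate clock exceeds the clock by at most 1, so one
    integrable bound serves all n.\<close>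
  proof (rule integral_dominated_convergence[where w="\<lambda>\<omega>. (S s \<omega> + 1) * (S t \<omega> + 1)"])
    show "AE \<omega> in M. norm (D n s \<omega> * D n t \<omega>) \<le> (S s \<omega> + 1) * (S t \<omega> + 1)" for n
      using Dle[OF s] Dle[OF t]
    proof eventually_elim
      case (elim \<omega>)
      then have "0 \<le> D n s \<omega>" "D n s \<omega> \<le> S s \<omega> + 1" "0 \<le> D n t \<omega>" "D n t \<omega> \<le> S t \<omega> + 1" by blast+
      then show ?case by (auto simp: abs_mult intro!: mult_mono)
    qed
    show "AE \<omega> in M. (\<lambda>n. D n s \<omega> * D n t \<omega>) \<longlonglongrightarrow> S s \<omega> * S t \<omega>"
      using Dlim[OF s] Dlim[OF t] by eventually_elim (rule tendsto_mult)
    show "integrable M (\<lambda>\<omega>. (S s \<omega> + 1) * (S t \<omega> + 1))"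
      using iSS[OF s t] iS[OF s] iS[OF t] by (simp add: distrib_left distrib_right)
  qed (use mD mS s t in auto)
  have eX: "expectation (X t) = a * b * t" if t: "0 \<le> t" for t
  proof -
    \<comment> \<open>The mean is treated as a product with the constant 1, so that the mean-square
      limit of products covers it too.\<close>
    have "(\<lambda>n. expectation (\<lambda>\<omega>. V n t \<omega> * 1)) \<longlonglongrightarrow> expectation (\<lambda>\<omega>. X t \<omega> * 1)"
      by (rule L2_tendsto_expectation_mult[OF mV[OF t] V2[OF t] _ _ mX[OF t] X2[OF t] _ _ limV[OF t]]) auto
    then have "(\<lambda>n. a * expectation (D n t)) \<longlonglongrightarrow> expectation (X t)" by (simp add: eV[OF t])
    moreover have "(\<lambda>n. a * expectation (D n t)) \<longlonglongrightarrow> a * expectation (S t)"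
      by (intro tendsto_intros limD t)
    ultimately have "expectation (X t) = a * expectation (S t)" by (rule LIMSEQ_unique)
    moreover have "expectation (S t) = b * t" using linS t by (simp add: linear_moments_def)
    ultimately show ?thesis by simp
  qed
  have emin: "expectation (\<lambda>\<omega>. min (S s \<omega>) (S t \<omega>)) = b * min s t" if s: "0 \<le> s" and t: "0 \<le> t" for s t
  proof -
    have "AE \<omega> in M. min (S s \<omega>) (S t \<omega>) = S (min s t) \<omega>"
    proof (cases "s \<le> t")
      case True
      show ?thesis using monoS[OF s True] by eventually_elim (use True in \<open>simp add: min_def\<close>)
    next
      case False
      then have "t \<le> s" by simp
      show ?thesis using monoS[OF t \<open>t \<le> s\<close>]
        by eventually_elim (use \<open>t \<le> s\<close> in \<open>simp add: min.absorb2\<close>)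
    qed
    then have "expectation (\<lambda>\<omega>. min (S s \<omega>) (S t \<omega>)) = expectation (S (min s t))"
      using mS s t by (intro integral_cong_AE) auto
    also have "\<dots> = b * min s t" using linS s t by (simp add: linear_moments_def)
    finally show ?thesis .
  qed
  have eXX: "expectation (\<lambda>\<omega>. X s \<omega> * X t \<omega>) = (v * b + a\<^sup>2 * w) * min s t + (a * b)\<^sup>2 * s * t"
    if s: "0 \<le> s" and t: "0 \<le> t" for s t
  proof -
    have "(\<lambda>n. expectation (\<lambda>\<omega>. V n s \<omega> * V n t \<omega>)) \<longlonglongrightarrow> expectation (\<lambda>\<omega>. X s \<omega> * X t \<omega>)"
      by (rule L2_tendsto_expectation_mult[OF mV[OF s] V2[OF s] mV[OF t] V2[OF t] mX[OF s] X2[OF s]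
          mX[OF t] X2[OF t] limV[OF s] limV[OF t]])
    moreover have "(\<lambda>n. expectation (\<lambda>\<omega>. V n s \<omega> * V n t \<omega>)) \<longlonglongrightarrow>
      v * expectation (\<lambda>\<omega>. min (S s \<omega>) (S t \<omega>)) + a\<^sup>2 * expectation (\<lambda>\<omega>. S s \<omega> * S t \<omega>)"
      unfolding eVV[OF s t order_refl] by (intro tendsto_intros limmin limDD s t)
    ultimately have "expectation (\<lambda>\<omega>. X s \<omega> * X t \<omega>) =
      v * expectation (\<lambda>\<omega>. min (S s \<omega>) (S t \<omega>)) + a\<^sup>2 * expectation (\<lambda>\<omega>. S s \<omega> * S t \<omega>)"
      by (rule LIMSEQ_unique)
    also have "expectation (\<lambda>\<omega>. S s \<omega> * S t \<omega>) = w * min s t + b\<^sup>2 * s * t"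
      using linS s t by (simp add: linear_moments_def)
    finally show ?thesis unfolding emin[OF s t] by (simp add: algebra_simps power2_eq_square)
  qed
  show ?thesis
    unfolding linear_moments_def using eXX eX X2 mX by simp
qed

section \<open>Decay of the correlation\<close>

text \<open>Centring removes the products of the means, and v, being positive, cancels in the
  correlation. For t at least s the normalised correlation is exactly \<open>sqrt s\<close>, so the
  limit is that of an eventually constant function and \<open>c\<close> is the square root.\<close>

lemma linear_moments_imp_long_range_dependent:
  assumes lin: "linear_moments a v {0..} (\<lambda>t. t) X" and v: "0 < v"
  shows "long_range_dependent X"
proof -
  have m: "X t \<in> borel_measurable M" "integrable M (\<lambda>\<omega>. (X t \<omega>)\<^sup>2)" "expectation (X t) = a * t" if "0 \<le> t" for t
    using lin that by (auto simp: linear_moments_def)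
  have cov: "covar (X s) (X t) = v * min s t" if "0 \<le> s" "0 \<le> t" for s t
  proof -
    have i: "integrable M (X s)" "integrable M (X t)" "integrable M (\<lambda>\<omega>. X s \<omega> * X t \<omega>)"
      using m that by (auto intro: integrable_of_square integrable_prod_of_squares)
    have "covar (X s) (X t) = expectation (\<lambda>\<omega>. X s \<omega> * X t \<omega> - a * t * X s \<omega> - a * s * X t \<omega> + a * s * (a * t))"
      unfolding covar_def m(3)[OF that(1)] m(3)[OF that(2)]
      by (rule Bochner_Integration.integral_cong) (simp_all add: algebra_simps)
    also have "\<dots> = expectation (\<lambda>\<omega>. X s \<omega> * X t \<omega>) - a * t * expectation (X s) - a * s * expectation (X t) + a * s * (a * t)"
      using i by (simp add: prob_space)
    also have "\<dots> = v * min s t"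
      using lin that m(3)[OF that(1)] m(3)[OF that(2)]
      by (simp add: linear_moments_def power2_eq_square algebra_simps)
    finally show ?thesis .
  qed
  have var: "variance (X t) = v * t" if "0 \<le> t" for t
    using cov[OF that that] by (simp add: covar_def power2_eq_square)
  have corr: "corr (X s) (X t) / t powr (- (1/2)) = sqrt s" if "0 < s" "s \<le> t" for s t
  proof -
    have t: "0 < t" using that by simp
    have "sqrt (v * s * (v * t)) = v * (sqrt s * sqrt t)"
      using v by (simp add: real_sqrt_mult mult.assoc mult.left_commute)
    then have "corr (X s) (X t) = s / (sqrt s * sqrt t)"
      using that t v by (simp add: corr_def cov var)
    also have "\<dots> = sqrt s / sqrt t" using that by (simp add: real_div_sqrt flip: divide_divide_eq_left)
    finally show ?thesis using t by (simp add: powr_minus powr_half_sqrt field_simps)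
  qed
  have "((\<lambda>t. corr (X s) (X t) / t powr (- (1/2))) \<longlongrightarrow> sqrt s) at_top" if "0 < s" for s
  proof (rule tendsto_eventually)
    show "eventually (\<lambda>t. corr (X s) (X t) / t powr (- (1/2)) = sqrt s) at_top"
      using eventually_ge_at_top[of s] by eventually_elim (use corr that in simp)
  qed
  then show ?thesis
    unfolding long_range_dependent_def
    by (intro conjI allI impI exI[of _ "1/2 :: real"] exI[of _ sqrt]) (use m var v in auto)
qed

section \<open>The tempered stable clock and the conclusion\<close>

lemma subordinator_AE_mono:
  assumes "subordinator S" "0 \<le> s" "s \<le> t"
  shows "AE \<omega> in M. S s \<omega> \<le> S t \<omega>"
proof -
  have "AE \<omega> in M. mono_on {0..} (\<lambda>t. S t \<omega>)" using assms by (simp add: subordinator_def)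
  then show ?thesis by eventually_elim (use assms in \<open>auto dest: mono_onD[of _ _ s t]\<close>)
qed

lemma subordinator_AE_nonneg:
  assumes "subordinator S" "0 \<le> t"
  shows "AE \<omega> in M. 0 \<le> S t \<omega>"
proof -
  have "AE \<omega> in M. S 0 \<omega> = 0" using assms by (simp add: subordinator_def levy_process_def)
  then show ?thesis using subordinator_AE_mono[OF assms(1) order_refl assms(2)] by eventually_elim simp
qed

text \<open>The mean rate is shown positive without differentiating the Laplace transform. If it
  were 0, then \<open>S 1\<close> would vanish almost surely and its transform at u = 1 would be 1;
  but the exponent there is strictly positive, as both powers increase and the nonnegative weights
  add up to 1.\<close>

lemma mtss_moments:
  assumes mtss: "mtss c1 c2 \<mu>1 \<mu>2 \<alpha>1 \<alpha>2 S"
    and c: "0 \<le> c1" "0 \<le> c2" "c1 + c2 = 1" and \<mu>: "0 < \<mu>1" "0 < \<mu>2" and \<alpha>: "0 < \<alpha>1" "0 < \<alpha>2"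
    and S2: "\<And>t. 0 \<le> t \<Longrightarrow> integrable M (\<lambda>\<omega>. (S t \<omega>)\<^sup>2)"
  obtains b w where "0 < b" "0 \<le> w" "linear_moments b w {0..} (\<lambda>t. t) S"
proof -
  have sub: "subordinator S" using mtss by (simp add: mtss_def)
  then have L: "levy_process S" by (simp add: subordinator_def)
  note nn = subordinator_AE_nonneg[OF sub]
  have m1: "S 1 \<in> borel_measurable M" using L by (simp add: levy_process_def)
  have i1: "integrable M (S 1)" using integrable_of_square[OF m1 S2] by simp
  have "expectation (S 1) \<noteq> 0"
  proof
    assume "expectation (S 1) = 0"
    then have "AE \<omega> in M. S 1 \<omega> = 0"
      using integral_nonneg_eq_0_iff_AE[OF i1] nn[of 1] by simp
    then have "expectation (\<lambda>\<omega>. exp (- 1 * S 1 \<omega>)) = expectation (\<lambda>\<omega>. 1)"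
      using m1 by (intro integral_cong_AE) auto
    then have "expectation (\<lambda>\<omega>. exp (- 1 * S 1 \<omega>)) = 1" by (simp add: prob_space)
    moreover have "expectation (\<lambda>\<omega>. exp (- u * S t \<omega>)) =
        exp (- t * (c1 * ((u + \<mu>1) powr \<alpha>1 - \<mu>1 powr \<alpha>1) + c2 * ((u + \<mu>2) powr \<alpha>2 - \<mu>2 powr \<alpha>2)))"
      if "0 \<le> t" "0 < u" for t u
      using mtss that unfolding mtss_def by blast
    from this[of 1 1] have "expectation (\<lambda>\<omega>. exp (- 1 * S 1 \<omega>)) =
        exp (- 1 * (c1 * ((1 + \<mu>1) powr \<alpha>1 - \<mu>1 powr \<alpha>1) + c2 * ((1 + \<mu>2) powr \<alpha>2 - \<mu>2 powr \<alpha>2)))"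
      by simp
    ultimately have 0: "c1 * ((1 + \<mu>1) powr \<alpha>1 - \<mu>1 powr \<alpha>1) + c2 * ((1 + \<mu>2) powr \<alpha>2 - \<mu>2 powr \<alpha>2) = 0"
      by simp
    have p: "0 < (1 + \<mu>1) powr \<alpha>1 - \<mu>1 powr \<alpha>1" "0 < (1 + \<mu>2) powr \<alpha>2 - \<mu>2 powr \<alpha>2"
      using \<mu> \<alpha> by (simp_all add: powr_less_mono2)
    from 0 p c have "c1 = 0" "c2 = 0"
      by (simp_all add: add_nonneg_eq_0_iff)
    then show False using c by simp
  qed
  moreover have "0 \<le> expectation (S 1)" using nn[of 1] by (intro integral_nonneg_AE) auto
  ultimately have "0 < expectation (S 1)" by simp
  then show ?thesis
    using that levy_process_moments(1)[OF L S2 nn] variance_positive by blast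
qed

end

text \<open>The two conditions on the jumps make the correlation meaningful: a finite second moment
  yields finite variances, and excluding \<open>indicat_real {0..}\<close>, the distribution
  function of the unit mass at 0, rules out a process that is almost surely 0.
  \<open>interval_measure H\<close> is the jump law itself.\<close>

theorem theorem3p3:
  fixes M :: "'a measure"
    and k :: nat
    and r c1 c2 \<mu>1 \<mu>2 \<alpha>1 \<alpha>2 :: real
    and H :: "real \<Rightarrow> real"
    and S Z1 :: "real \<Rightarrow> 'a \<Rightarrow> real"
  assumes "prob_space M"
    and "1 \<le> k" and "0 < r"
    and "0 \<le> c1" and "0 \<le> c2" and "c1 + c2 = 1"
    and "0 < \<mu>1" and "0 < \<mu>2"
    and "0 < \<alpha>1" and "\<alpha>1 < 1" and "0 < \<alpha>2" and "\<alpha>2 < 1"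
    and "prob_space.mtss M c1 c2 \<mu>1 \<mu>2 \<alpha>1 \<alpha>2 S"
    and "prob_space.tcppok M k r H S Z1"
    and H_second_moment: "integrable (interval_measure H) (\<lambda>y. y\<^sup>2)"
    and H_not_null: "H \<noteq> indicat_real {0..}"
  shows "prob_space.long_range_dependent M Z1"
proof -
  interpret prob_space M by fact
  have sub: "subordinator S"
    using \<open>mtss c1 c2 \<mu>1 \<mu>2 \<alpha>1 \<alpha>2 S\<close> by (simp add: mtss_def)
  then have S: "levy_process S" by (simp add: subordinator_def)
  obtain Z where Z: "cppok k r H Z" and ind: "indep_families {0..} borel Z {0..} borel S"
    and eq: "\<And>t \<omega>. 0 \<le> t \<Longrightarrow> \<omega> \<in> space M \<Longrightarrow> Z1 t \<omega> = Z (S t \<omega>) \<omega>"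
    and mZ1: "\<And>t. 0 \<le> t \<Longrightarrow> Z1 t \<in> borel_measurable M"
    and Sp: "\<And>t \<rho>. 0 \<le> t \<Longrightarrow> 0 < \<rho> \<Longrightarrow> integrable M (\<lambda>\<omega>. S t \<omega> powr \<rho>)"
    using \<open>tcppok k r H S Z1\<close> unfolding tcppok_def by blast
  note monoS = subordinator_AE_mono[OF sub] and S0 = subordinator_AE_nonneg[OF sub]
  have S2: "integrable M (\<lambda>\<omega>. (S t \<omega>)\<^sup>2)" if "0 \<le> t" for t
  proof -
    have m: "S t \<in> borel_measurable M" using S that by (simp add: levy_process_def)
    \<comment> \<open>The definition supplies moments as real powers; the power with exponent 2 is
      identified with the square almost surely, where the clock is nonnegative.\<close>
    have "integrable M (\<lambda>\<omega>. S t \<omega> powr 2) \<longleftrightarrow> integrable M (\<lambda>\<omega>. (S t \<omega>)\<^sup>2)"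
    proof (rule integrable_cong_AE)
      show "AE \<omega> in M. S t \<omega> powr 2 = (S t \<omega>)\<^sup>2"
        using S0[OF that] by eventually_elim (simp add: powr_numeral)
    qed (use m in auto)
    then show ?thesis using Sp[OF that, of 2] by simp
  qed
  obtain b w where bw: "0 < b" "0 \<le> w" "linear_moments b w {0..} (\<lambda>t. t) S"
    using mtss_moments[OF \<open>mtss c1 c2 \<mu>1 \<mu>2 \<alpha>1 \<alpha>2 S\<close> _ _ _ _ _ _ _ S2] assms by blast
  obtain a v where av: "0 < v" "linear_moments a v {0..} (\<lambda>t. t) Z"
    using cppok_moments[OF Z _ _ H_second_moment H_not_null] assms by blast
  have rc: "AE \<omega> in M. \<forall>t\<ge>0. ((\<lambda>s. Z s \<omega>) \<longlongrightarrow> Z t \<omega>) (at_right t)"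
    using cppok_right_constant[OF Z] by eventually_elim (blast intro: tendsto_eventually)
  have "linear_moments (a * b) (v * b + a\<^sup>2 * w) {0..} (\<lambda>t. t) Z1"
    by (rule linear_moments_time_change[OF av(2) less_imp_le[OF av(1)] ind bw(3) S0 monoS rc mZ1 eq])
  moreover have "0 < v * b + a\<^sup>2 * w" using av bw by (auto intro!: add_pos_nonneg)
  ultimately show ?thesis by (rule linear_moments_imp_long_range_dependent)
qed

end
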